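(* Let $\mathscr{F}$ be a fixed language of (partial) algebras, let $\mathscr{P}$ be a collection of partial algebras $\mathbf{P}$ in the language $\mathscr{F}$, let $\Sigma$ be a set of universal Horn sentences in the language $\mathscr{F}$, and let $\delta(x)$ be a conjunction of atomic formulas in the single free variable $x$. Suppose that $\Sigma\cup\{(\forall x)\,\delta(x)\}$ is a set of laws for $\mathscr{P}$ (that is, $\mathscr{P}\models\sigma$ for every $\sigma\in\Sigma$, and $\mathscr{P}\models(\forall x)\,\delta(x)$) and that $\delta(x)$ is $\mathscr{P}$-total. Then the following two conditions are equivalent: (1) for every universal Horn sentence $\sigma$ in the language $\mathscr{F}$, if $\Sigma\vdash\sigma|_\delta$ then $\mathscr{P}\models\sigma$; (2) $\mathscr{P}\hookrightarrow\mathsf{Mod}(\Sigma)$, i.e., every $\mathbf{P}\in\mathscr{P}$ embeds into some total algebra $\mathbf{Q}$ satisfying $\Sigma$.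
   Context: All partial algebras belong to a fixed language $\mathscr{F}$ of operation symbols, so atomic formulas are equations between terms. A partial algebra $\mathbf{P}=\langle P,\mathscr{F}\rangle$ has a universe $P$ and, for each operation symbol $f\in\mathscr{F}$, a partial operation $f^{\mathbf{P}}$ on $P$ with domain $\mathrm{Dom}(f^{\mathbf{P}})$. It is a total algebra if all its operations are defined everywhere. Write $\mathbf{x}$ for $x_1,\dots,x_m$ and $(\forall\mathbf{x})$ for $(\forall x_1)\cdots(\forall x_m)$. A term $t(\mathbf{x})$ defines a partial operation $t^{\mathbf{P}}$ on $P$ with domain $\mathrm{Dom}(t^{\mathbf{P}})\subseteq P^m$ (the value is defined exactly when all subterms can be evaluated). For an open (quantifier-free) formula $\omega(\mathbf{x})$, $\mathrm{Dom}_{\mathbf{P}}(\omega)\subseteq P^m$ is the intersection of the sets $\mathrm{Dom}(t^{\mathbf{P}})$ over all terms $t$ appearing in $\omega$. The formula $\omega$ is $\mathbf{P}$-total if $\mathrm{Dom}_{\mathbf{P}}(\omega)=P^m$, and $\mathscr{P}$-total if it is $\mathbf{P}$-total for every $\mathbf{P}\in\mathscr{P}$. A universal Horn sentence is a sentence $\sigma=(\forall\mathbf{x})\,\omega(\mathbf{x})$ with $\omega$ an open Horn formula, i.e., a conjunction of Horn clauses, where a Horn clause is a disjunction of atomic and negated atomic formulas with at most one unnegated atomic formula (clauses with no unnegated atomic formula are allowed). Set $\mathrm{Dom}_{\mathbf{P}}(\sigma):=\mathrm{Dom}_{\mathbf{P}}(\omega)$. Satisfaction in partial algebras: $\mathbf{P}\models\sigma$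 means that $\omega(\mathbf{p})$ is true in $\mathbf{P}$ for all $\mathbf{p}\in\mathrm{Dom}_{\mathbf{P}}(\sigma)$. $\mathbf{P}\models\Sigma$ means $\mathbf{P}\models\sigma$ for all $\sigma\in\Sigma$. $\mathscr{P}\models\sigma$ means $\mathbf{P}\models\sigma$ for all $\mathbf{P}\in\mathscr{P}$; then $\sigma$ is called a law of $\mathscr{P}$. The same definition applies to $(\forall x)\,\delta(x)$. $\sigma|_\delta$ is the universal Horn sentence obtained from $\sigma=(\forall\mathbf{x})\,\omega(\mathbf{x})$ by relativizing the quantifiers to $\delta$, i.e., $(\forall\mathbf{x})\big[\big(\bigwedge_{1\le i\le m}\delta(x_i)\big)\rightarrow\omega(\mathbf{x})\big]$. $\Sigma\vdash\tau$ means there is a derivation of $\tau$ from $\Sigma$ in ordinary first-order logic with equality (operation symbols treated as total). $\mathsf{Mod}(\Sigma)$ is the collection of total algebras satisfying $\Sigma$. An embedding of a partial algebra $\mathbf{P}$ into a partial algebra $\mathbf{Q}$ is a one-to-one map $\alpha:P\to Q$ such that for each fundamental operation $f$ and each $\mathbf{p}\in\mathrm{Dom}(f^{\mathbf{P}})$, one has $\alpha(\mathbf{p})\in\mathrm{Dom}(f^{\mathbf{Q}})$ (with $\alpha$ applied coordinatewise) and $f^{\mathbf{Q}}(\alpha(\mathbf{p}))=\alpha(f^{\mathbf{P}}(\mathbf{p}))$. $\mathbf{P}\hookrightarrow\mathsf{Mod}(\Sigma)$ means there are $\mathbf{Q}\in\mathsf{Mod}(\Sigma)$ and an embedding of $\mathbf{P}$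 into $\mathbf{Q}$; $\mathscr{P}\hookrightarrow\mathsf{Mod}(\Sigma)$ means this holds for every $\mathbf{P}\in\mathscr{P}$. *)

theory Defs
  imports Main
begin

section \<open>Terms and first-order formulas\<close>

text \<open>The domain of the map is the set of operation symbols, and its values are their arities.\<close>

type_synonym 'f lang = "'f \<rightharpoonup> nat"

datatype (funs: 'f, vars: 'v) trm = Var 'v | Fun 'f "('f, 'v) trm list"

text \<open>Formulas use de Bruijn indices: \<open>Var 0\<close> refers to the innermost enclosing quantifier.
  The remaining connectives are classical abbreviations.\<close>

datatype 'f fm =
    Eq "('f, nat) trm" "('f, nat) trm"
  | Bot
  | Imp "'f fm" "'f fm"
  | All "'f fm"

abbreviation Neg :: "'f fm \<Rightarrow> 'f fm" where
  "Neg \<phi> \<equiv> Imp \<phi> Bot"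

abbreviation Top :: "'f fm" where
  "Top \<equiv> Neg Bot"

abbreviation Or :: "'f fm \<Rightarrow> 'f fm \<Rightarrow> 'f fm" where
  "Or \<phi> \<psi> \<equiv> Imp (Neg \<phi>) \<psi>"

abbreviation And :: "'f fm \<Rightarrow> 'f fm \<Rightarrow> 'f fm" where
  "And \<phi> \<psi> \<equiv> Neg (Imp \<phi> (Neg \<psi>))"

definition Conj :: "'f fm list \<Rightarrow> 'f fm" where
  "Conj \<phi>s = foldr And \<phi>s Top"

definition Disj :: "'f fm list \<Rightarrow> 'f fm" where
  "Disj \<phi>s = foldr Or \<phi>s Bot"

fun lang_trm :: "'f lang \<Rightarrow> ('f, 'v) trm \<Rightarrow> bool" where
  "lang_trm L (Var i) \<longleftrightarrow> True"
| "lang_trm L (Fun f ts) \<longleftrightarrow> L f = Some (length ts) \<and> (\<forall>t\<in>set ts. lang_trm L t)"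

primrec lang_fm :: "'f lang \<Rightarrow> 'f fm \<Rightarrow> bool" where
  "lang_fm L (Eq s t) \<longleftrightarrow> lang_trm L s \<and> lang_trm L t"
| "lang_fm L Bot \<longleftrightarrow> True"
| "lang_fm L (Imp \<phi> \<psi>) \<longleftrightarrow> lang_fm L \<phi> \<and> lang_fm L \<psi>"
| "lang_fm L (All \<phi>) \<longleftrightarrow> lang_fm L \<phi>"

primrec free_below :: "nat \<Rightarrow> 'f fm \<Rightarrow> bool" where
  "free_below n (Eq s t) \<longleftrightarrow> (\<forall>i\<in>vars s \<union> vars t. i < n)"
| "free_below n Bot \<longleftrightarrow> True"
| "free_below n (Imp \<phi> \<psi>) \<longleftrightarrow> free_below n \<phi> \<and> free_below n \<psi>"
| "free_below n (All \<phi>) \<longleftrightarrow> free_below (Suc n) \<phi>"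

definition wf_fm :: "'f lang \<Rightarrow> nat \<Rightarrow> 'f fm \<Rightarrow> bool" where
  "wf_fm L n \<phi> \<longleftrightarrow> lang_fm L \<phi> \<and> free_below n \<phi>"

primrec subst_trm :: "('v \<Rightarrow> ('f, 'w) trm) \<Rightarrow> ('f, 'v) trm \<Rightarrow> ('f, 'w) trm" where
  "subst_trm s (Var i) = s i"
| "subst_trm s (Fun f ts) = Fun f (map (subst_trm s) ts)"

definition shift :: "('f, nat) trm \<Rightarrow> ('f, nat) trm" where
  "shift = subst_trm (\<lambda>i. Var (Suc i))"

primrec subst_fm :: "(nat \<Rightarrow> ('f, nat) trm) \<Rightarrow> 'f fm \<Rightarrow> 'f fm" where
  "subst_fm s (Eq t u) = Eq (subst_trm s t) (subst_trm s u)"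
| "subst_fm s Bot = Bot"
| "subst_fm s (Imp \<phi> \<psi>) = Imp (subst_fm s \<phi>) (subst_fm s \<psi>)"
| "subst_fm s (All \<phi>) = All (subst_fm (case_nat (Var 0) (\<lambda>i. shift (s i))) \<phi>)"

definition shift_fm :: "'f fm \<Rightarrow> 'f fm" where
  "shift_fm = subst_fm (\<lambda>i. Var (Suc i))"

text \<open>Instantiation of the variable with index \<open>0\<close> of the body of a quantifier.\<close>

definition inst :: "'f fm \<Rightarrow> ('f, nat) trm \<Rightarrow> 'f fm" where
  "inst \<phi> t = subst_fm (case_nat t Var) \<phi>"

section \<open>Derivability\<close>

text \<open>Classical natural deduction for first-order logic with equality.  In \<open>AllI\<close>, shifting the
  hypotheses makes the variable \<open>0\<close> of \<open>\<phi>\<close> an eigenvariable.\<close>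

inductive derives :: "'f lang \<Rightarrow> 'f fm set \<Rightarrow> 'f fm \<Rightarrow> bool" for L :: "'f lang" where
  Assm: "\<phi> \<in> \<Gamma> \<Longrightarrow> derives L \<Gamma> \<phi>"
| ImpI: "lang_fm L \<phi> \<Longrightarrow> derives L (insert \<phi> \<Gamma>) \<psi> \<Longrightarrow> derives L \<Gamma> (Imp \<phi> \<psi>)"
| ImpE: "derives L \<Gamma> (Imp \<phi> \<psi>) \<Longrightarrow> derives L \<Gamma> \<phi> \<Longrightarrow> derives L \<Gamma> \<psi>"
| Contr: "lang_fm L \<phi> \<Longrightarrow> derives L (insert (Neg \<phi>) \<Gamma>) Bot \<Longrightarrow> derives L \<Gamma> \<phi>"
| AllI: "derives L (shift_fm ` \<Gamma>) \<phi> \<Longrightarrow> derives L \<Gamma> (All \<phi>)"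
| AllE: "derives L \<Gamma> (All \<phi>) \<Longrightarrow> lang_trm L t \<Longrightarrow> derives L \<Gamma> (inst \<phi> t)"
| EqI: "lang_trm L t \<Longrightarrow> derives L \<Gamma> (Eq t t)"
| EqE: "derives L \<Gamma> (Eq s t) \<Longrightarrow> derives L \<Gamma> (inst \<phi> s) \<Longrightarrow> derives L \<Gamma> (inst \<phi> t)"

section \<open>Universal Horn sentences\<close>

text \<open>\<open>Univ m \<omega>\<close> is the prenex sentence \<open>(\<forall>x\<^sub>0 \<dots> x\<^sub>m\<^sub>-\<^sub>1) \<omega>\<close>, where \<open>x\<^sub>i\<close> is \<open>Var i\<close>.  It is kept in
  this form because the domain of \<open>\<omega>\<close> in a partial algebra is a set of \<open>m\<close>-tuples.\<close>

datatype 'f usent = Univ nat "'f fm"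

fun sentence :: "'f usent \<Rightarrow> 'f fm" where
  "sentence (Univ m \<omega>) = (All ^^ m) \<omega>"

definition atomic :: "'f fm \<Rightarrow> bool" where
  "atomic \<phi> \<longleftrightarrow> (\<exists>s t. \<phi> = Eq s t)"

definition negated_atomic :: "'f fm \<Rightarrow> bool" where
  "negated_atomic \<phi> \<longleftrightarrow> (\<exists>\<psi>. atomic \<psi> \<and> \<phi> = Neg \<psi>)"

definition horn_clause :: "'f fm \<Rightarrow> bool" where
  "horn_clause \<phi> \<longleftrightarrow> (\<exists>ls. \<phi> = Disj ls \<and> (\<forall>l\<in>set ls. atomic l \<or> negated_atomic l)
     \<and> length (filter atomic ls) \<le> 1)"

definition horn_formula :: "'f fm \<Rightarrow> bool" where
  "horn_formula \<phi> \<longleftrightarrow> (\<exists>cs. \<phi> = Conj cs \<and> (\<forall>c\<in>set cs. horn_clause c))"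

definition conj_of_atoms :: "'f fm \<Rightarrow> bool" where
  "conj_of_atoms \<phi> \<longleftrightarrow> (\<exists>as. \<phi> = Conj as \<and> (\<forall>a\<in>set as. atomic a))"

fun universal_horn :: "'f lang \<Rightarrow> 'f usent \<Rightarrow> bool" where
  "universal_horn L (Univ m \<omega>) \<longleftrightarrow> wf_fm L m \<omega> \<and> horn_formula \<omega>"

text \<open>The relativization \<open>\<sigma>|\<^sub>\<delta>\<close>; the free variable of \<open>\<delta>\<close> is \<open>Var 0\<close>, so \<open>subst_fm (\<lambda>_. Var i) \<delta>\<close>
  is \<open>\<delta>(x\<^sub>i)\<close>.\<close>

fun relativize :: "'f fm \<Rightarrow> 'f usent \<Rightarrow> 'f usent" where
  "relativize \<delta> (Univ m \<omega>) =
     Univ m (Imp (Conj (map (\<lambda>i. subst_fm (\<lambda>_. Var i) \<delta>) [0..<m])) \<omega>)"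

section \<open>Partial algebras\<close>

record ('f, 'a) palg =
  univ :: "'a set"
  oper :: "'f \<Rightarrow> 'a list \<rightharpoonup> 'a"

definition tuples :: "('f, 'a) palg \<Rightarrow> nat \<Rightarrow> 'a list set" where
  "tuples P m = {p. length p = m \<and> set p \<subseteq> univ P}"

definition partial_algebra :: "'f lang \<Rightarrow> ('f, 'a) palg \<Rightarrow> bool" where
  "partial_algebra L P \<longleftrightarrow>
     (\<forall>f n. L f = Some n \<longrightarrow> dom (oper P f) \<subseteq> tuples P n \<and> ran (oper P f) \<subseteq> univ P)"

definition total_algebra :: "'f lang \<Rightarrow> ('f, 'a) palg \<Rightarrow> bool" where
  "total_algebra L P \<longleftrightarrow>
     partial_algebra L P \<and> (\<forall>f n. L f = Some n \<longrightarrow> dom (oper P f) = tuples P n)"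

text \<open>\<open>eval P p t\<close> is the value of \<open>t\<close> in \<open>P\<close> at the tuple \<open>p\<close>; it is defined iff all subterms of
  \<open>t\<close> can be evaluated.\<close>

primrec eval :: "('f, 'a) palg \<Rightarrow> 'a list \<Rightarrow> ('f, nat) trm \<Rightarrow> 'a option" where
  "eval P p (Var i) = (if i < length p then Some (p ! i) else None)"
| "eval P p (Fun f ts) = Option.bind (those (map (eval P p) ts)) (oper P f)"

primrec terms_of :: "'f fm \<Rightarrow> ('f, nat) trm set" where
  "terms_of (Eq s t) = {s, t}"
| "terms_of Bot = {}"
| "terms_of (Imp \<phi> \<psi>) = terms_of \<phi> \<union> terms_of \<psi>"
| "terms_of (All \<phi>) = terms_of \<phi>"

text \<open>\<open>Dom P m \<omega>\<close> is meant for open formulas \<open>\<omega>\<close> in the variables \<open>x\<^sub>0, \<dots>, x\<^sub>m\<^sub>-\<^sub>1\<close>, and \<open>holds P p \<omega>\<close>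
  for tuples \<open>p\<close> in that domain, where all terms involved are defined.\<close>

definition Dom :: "('f, 'a) palg \<Rightarrow> nat \<Rightarrow> 'f fm \<Rightarrow> 'a list set" where
  "Dom P m \<omega> = {p \<in> tuples P m. \<forall>t\<in>terms_of \<omega>. eval P p t \<noteq> None}"

primrec holds :: "('f, 'a) palg \<Rightarrow> 'a list \<Rightarrow> 'f fm \<Rightarrow> bool" where
  "holds P p (Eq s t) \<longleftrightarrow> (\<exists>a. eval P p s = Some a \<and> eval P p t = Some a)"
| "holds P p Bot \<longleftrightarrow> False"
| "holds P p (Imp \<phi> \<psi>) \<longleftrightarrow> (holds P p \<phi> \<longrightarrow> holds P p \<psi>)"
| "holds P p (All \<phi>) \<longleftrightarrow> (\<forall>a\<in>univ P. holds P (a # p) \<phi>)"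

fun satisfies :: "('f, 'a) palg \<Rightarrow> 'f usent \<Rightarrow> bool" where
  "satisfies P (Univ m \<omega>) \<longleftrightarrow> (\<forall>p\<in>Dom P m \<omega>. holds P p \<omega>)"

definition law :: "('f, 'a) palg set \<Rightarrow> 'f usent \<Rightarrow> bool" where
  "law \<P> \<sigma> \<longleftrightarrow> (\<forall>P\<in>\<P>. satisfies P \<sigma>)"

definition total_for :: "('f, 'a) palg set \<Rightarrow> nat \<Rightarrow> 'f fm \<Rightarrow> bool" where
  "total_for \<P> m \<omega> \<longleftrightarrow> (\<forall>P\<in>\<P>. Dom P m \<omega> = tuples P m)"

definition embedding :: "'f lang \<Rightarrow> ('f, 'a) palg \<Rightarrow> ('f, 'b) palg \<Rightarrow> ('a \<Rightarrow> 'b) \<Rightarrow> bool" where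
  "embedding L P Q \<alpha> \<longleftrightarrow> inj_on \<alpha> (univ P) \<and> \<alpha> ` univ P \<subseteq> univ Q \<and>
     (\<forall>f\<in>dom L. \<forall>p\<in>dom (oper P f).
        map \<alpha> p \<in> dom (oper Q f) \<and> oper Q f (map \<alpha> p) = map_option \<alpha> (oper P f p))"

text \<open>As usual in first-order logic, models have a nonempty universe; the partial algebras to be
  embedded may be empty.\<close>

definition Mod :: "'f lang \<Rightarrow> 'f usent set \<Rightarrow> ('f, 'a) palg set" where
  "Mod L \<Sigma> = {Q. total_algebra L Q \<and> univ Q \<noteq> {} \<and> (\<forall>\<sigma>\<in>\<Sigma>. satisfies Q \<sigma>)}"

text \<open>The first argument fixes the type in which the universes of the total algebras are taken, since
  an existential quantifier cannot range over types.\<close>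

definition embeds_into_Mod ::
    "'u itself \<Rightarrow> 'f lang \<Rightarrow> ('f, 'a) palg set \<Rightarrow> 'f usent set \<Rightarrow> bool" where
  "embeds_into_Mod _ L \<P> \<Sigma> \<longleftrightarrow>
     (\<forall>P\<in>\<P>. \<exists>Q \<in> (Mod L \<Sigma> :: ('f, 'u) palg set). \<exists>\<alpha>. embedding L P Q \<alpha>)"

end

theory Submission
  imports Defs
begin

text \<open>
  The theorem is a compactness argument for Horn logic, in which the derivability relation itself
  supplies the model.

  Suppose that each \<open>P\<close> in the collection embeds into a total model \<open>Q\<close> of \<open>\<Sigma>\<close>, and that
  \<open>\<sigma>|\<^sub>\<delta>\<close> is derivable from \<open>\<Sigma>\<close>.  By soundness (\<open>derives_sound\<close>) \<open>Q\<close> satisfies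
  \<open>\<sigma>|\<^sub>\<delta>\<close>.  An embedding preserves and reflects the truth of an open formula at every tuple where all its
  terms are defined in \<open>P\<close> (\<open>holds_iff_sat\<close>): values are carried along, and equations are
  reflected since the map is one-to-one.  As \<open>\<delta>\<close> is defined and true at every element of \<open>P\<close>, the
  image of \<open>P\<close> lies in the part of \<open>Q\<close> to which the quantifiers are relativized, and so \<open>\<sigma>\<close>
  is reflected from \<open>Q\<close> to \<open>P\<close> (\<open>relativized_consequence_holds\<close>).

  Conversely, suppose that \<open>P\<close> satisfies each universal Horn sentence whose relativization is
  derivable from \<open>\<Sigma>\<close>.  As relativizing weakens a sentence, \<open>P\<close> satisfies all universal Horn
  consequences of \<open>\<Sigma>\<close> (\<open>derives_relativize\<close>).  The model is the total algebra presented by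
  generators and relations from \<open>P\<close>.  Its elements are represented by terms in the elements of \<open>P\<close>
  and possibly some further free generators; two terms are identified when their equality
  follows from \<open>\<Sigma>\<close> together with finitely many entries \<open>f(p\<^sub>1, \<dots>, p\<^sub>n) = b\<close> of the operation
  tables of \<open>P\<close>.  The equality rules make this a congruence, and the entries make the operations
  of \<open>P\<close> compatible with those of the quotient.

  The quotient satisfies a Horn clause of \<open>\<Sigma>\<close> because there is at most one positive literal:
  once the equations in the negative literals hold, each from finitely many entries, the
  positive one follows from the union of these finite sets (\<open>model_satisfies_clause\<close>).  For
  a clause with two positive literals the disjunction would follow, but perhaps neither
  disjunct.  Finally, if \<open>a = b\<close> or falsity follows from \<open>\<Sigma>\<close> and finitely many entries, then the
  implication from these entries to \<open>a = b\<close> or to falsity is a universal Horn consequence of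
  \<open>\<Sigma>\<close>, hence satisfied in \<open>P\<close>.  All its terms are defined at the elements concerned and its
  premises are true there, so \<open>a = b\<close> already in \<open>P\<close>, respectively a contradiction
  (\<open>forced_equation_holds\<close>).  This shows that generators stay distinct and that clauses
  without positive literal hold as well.
\<close>

section \<open>Substitution\<close>

lemma subst_trm_Var: "subst_trm Var t = t"
  by (induction t) (auto intro: map_idI)

lemma subst_trm_subst_trm:
  "subst_trm s (subst_trm r t) = subst_trm (\<lambda>i. subst_trm s (r i)) t"
  by (induction t) auto

lemma subst_trm_cong: "(\<And>i. i \<in> vars t \<Longrightarrow> s i = r i) \<Longrightarrow> subst_trm s t = subst_trm r t"
  by (induction t) auto

lemma subst_trm_shift: "subst_trm (case_nat t s) (shift u) = subst_trm s u"
  by (simp add: shift_def subst_trm_subst_trm)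

lemma lang_trm_subst: "lang_trm L t \<Longrightarrow> (\<And>i. i \<in> vars t \<Longrightarrow> lang_trm L (s i)) \<Longrightarrow> lang_trm L (subst_trm s t)"
  by (induction t) auto

lemma lang_trm_shift: "lang_trm L t \<Longrightarrow> lang_trm L (shift t)"
  by (simp add: shift_def lang_trm_subst)

lemma lang_fm_subst:
  "lang_fm L \<phi> \<Longrightarrow> free_below n \<phi> \<Longrightarrow> (\<And>i. i < n \<Longrightarrow> lang_trm L (s i)) \<Longrightarrow> lang_fm L (subst_fm s \<phi>)"
proof (induction \<phi> arbitrary: n s)
  case (All \<phi>)
  have "lang_fm L (subst_fm (case_nat (Var 0) (\<lambda>i. shift (s i))) \<phi>)"
    by (rule All.IH[of "Suc n"]) (use All.prems in \<open>auto simp: lang_trm_shift split: nat.split\<close>)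
  then show ?case by simp
qed (auto intro: lang_trm_subst)

lemma subst_fm_cong:
  "free_below n \<phi> \<Longrightarrow> (\<And>i. i < n \<Longrightarrow> s i = r i) \<Longrightarrow> subst_fm s \<phi> = subst_fm r \<phi>"
proof (induction \<phi> arbitrary: n s r)
  case (Eq t u)
  then show ?case by (auto intro: subst_trm_cong)
next
  case (Imp \<phi> \<psi>)
  then show ?case by (metis free_below.simps(3) subst_fm.simps(3))
next
  case (All \<phi>)
  have "subst_fm (case_nat (Var 0) (\<lambda>i. shift (s i))) \<phi>
      = subst_fm (case_nat (Var 0) (\<lambda>i. shift (r i))) \<phi>"
    by (rule All.IH[of "Suc n"]) (use All.prems in \<open>auto split: nat.split\<close>)
  then show ?case by simp
qed simp

lemma subst_fm_Var: "subst_fm Var \<phi> = \<phi>"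
  for \<phi> :: "'f fm"
proof (induction \<phi>)
  case (All \<phi>)
  have "case_nat (Var 0) (\<lambda>i. shift (Var i)) = (Var :: nat \<Rightarrow> ('f, nat) trm)"
    by (rule ext) (simp add: shift_def split: nat.split)
  with All show ?case by simp
qed (simp_all add: subst_trm_Var)

lemma subst_fm_subst_fm:
  "subst_fm s (subst_fm r \<phi>) = subst_fm (\<lambda>i. subst_trm s (r i)) \<phi>"
proof (induction \<phi> arbitrary: s r)
  case (All \<phi>)
  have "(\<lambda>i. subst_trm (case_nat (Var 0) (\<lambda>i. shift (s i))) (case_nat (Var 0) (\<lambda>i. shift (r i)) i))
      = case_nat (Var 0) (\<lambda>i. shift (subst_trm s (r i)))"
    by (rule ext) (simp add: shift_def subst_trm_subst_trm split: nat.split)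
  with All show ?case by simp
qed (simp_all add: subst_trm_subst_trm)

lemma free_below_All_power: "free_below n ((All ^^ m) \<phi>) \<longleftrightarrow> free_below (m + n) \<phi>"
  by (induction m arbitrary: n) auto

lemma shift_fm_closed: "free_below 0 \<phi> \<Longrightarrow> shift_fm \<phi> = \<phi>"
  unfolding shift_fm_def using subst_fm_cong[of 0 \<phi> _ Var] by (simp add: subst_fm_Var)

section \<open>Conjunctions, disjunctions and open formulas\<close>

lemma subst_fm_Conj: "subst_fm s (Conj \<phi>s) = Conj (map (subst_fm s) \<phi>s)"
  by (induction \<phi>s) (auto simp: Conj_def)

lemma subst_fm_Disj: "subst_fm s (Disj \<phi>s) = Disj (map (subst_fm s) \<phi>s)"
  by (induction \<phi>s) (auto simp: Disj_def)

lemma lang_fm_Conj: "lang_fm L (Conj \<phi>s) \<longleftrightarrow> (\<forall>\<phi>\<in>set \<phi>s. lang_fm L \<phi>)"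
  by (induction \<phi>s) (auto simp: Conj_def)

lemma lang_fm_Disj: "lang_fm L (Disj \<phi>s) \<longleftrightarrow> (\<forall>\<phi>\<in>set \<phi>s. lang_fm L \<phi>)"
  by (induction \<phi>s) (auto simp: Disj_def)

lemma free_below_Conj: "free_below n (Conj \<phi>s) \<longleftrightarrow> (\<forall>\<phi>\<in>set \<phi>s. free_below n \<phi>)"
  by (induction \<phi>s) (auto simp: Conj_def)

lemma free_below_Disj: "free_below n (Disj \<phi>s) \<longleftrightarrow> (\<forall>\<phi>\<in>set \<phi>s. free_below n \<phi>)"
  by (induction \<phi>s) (auto simp: Disj_def)

lemma terms_of_Conj: "terms_of (Conj \<phi>s) = (\<Union>\<phi>\<in>set \<phi>s. terms_of \<phi>)"
  by (induction \<phi>s) (auto simp: Conj_def)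

lemma terms_of_Disj: "terms_of (Disj \<phi>s) = (\<Union>\<phi>\<in>set \<phi>s. terms_of \<phi>)"
  by (induction \<phi>s) (auto simp: Disj_def)

lemma holds_Conj: "holds P p (Conj \<phi>s) \<longleftrightarrow> (\<forall>\<phi>\<in>set \<phi>s. holds P p \<phi>)"
  by (induction \<phi>s) (auto simp: Conj_def)

lemma holds_Disj: "holds P p (Disj \<phi>s) \<longleftrightarrow> (\<exists>\<phi>\<in>set \<phi>s. holds P p \<phi>)"
  by (induction \<phi>s) (auto simp: Disj_def)


primrec quantifier_free :: "'f fm \<Rightarrow> bool" where
  "quantifier_free (Eq s t) \<longleftrightarrow> True"
| "quantifier_free Bot \<longleftrightarrow> True"
| "quantifier_free (Imp \<phi> \<psi>) \<longleftrightarrow> quantifier_free \<phi> \<and> quantifier_free \<psi>"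
| "quantifier_free (All \<phi>) \<longleftrightarrow> False"

lemma quantifier_free_Conj: "quantifier_free (Conj \<phi>s) \<longleftrightarrow> (\<forall>\<phi>\<in>set \<phi>s. quantifier_free \<phi>)"
  by (induction \<phi>s) (auto simp: Conj_def)

lemma quantifier_free_Disj: "quantifier_free (Disj \<phi>s) \<longleftrightarrow> (\<forall>\<phi>\<in>set \<phi>s. quantifier_free \<phi>)"
  by (induction \<phi>s) (auto simp: Disj_def)

lemma quantifier_free_horn: "horn_formula \<omega> \<Longrightarrow> quantifier_free \<omega>"
  by (fastforce simp: horn_formula_def horn_clause_def atomic_def negated_atomic_def
      quantifier_free_Conj quantifier_free_Disj)

lemma quantifier_free_conj_of_atoms: "conj_of_atoms \<delta> \<Longrightarrow> quantifier_free \<delta>"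
  by (fastforce simp: conj_of_atoms_def atomic_def quantifier_free_Conj)

lemma wf_terms_of:
  "quantifier_free \<phi> \<Longrightarrow> wf_fm L n \<phi> \<Longrightarrow> t \<in> terms_of \<phi> \<Longrightarrow> lang_trm L t \<and> (\<forall>i\<in>vars t. i < n)"
  by (induction \<phi>) (auto simp: wf_fm_def)

section \<open>Soundness\<close>

text \<open>Soundness is stated for assignments of values to all variables at once, because a derivation
  may pass through formulas with more free variables than its end formula.  With \<open>F\<close> a total
  function, a term always has a value, which is meaningful for terms in the language.\<close>

primrec val :: "('f \<Rightarrow> 'u list \<Rightarrow> 'u) \<Rightarrow> ('v \<Rightarrow> 'u) \<Rightarrow> ('f, 'v) trm \<Rightarrow> 'u" where
  "val F \<rho> (Var i) = \<rho> i"
| "val F \<rho> (Fun f ts) = F f (map (val F \<rho>) ts)"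

primrec sat :: "'u set \<Rightarrow> ('f \<Rightarrow> 'u list \<Rightarrow> 'u) \<Rightarrow> (nat \<Rightarrow> 'u) \<Rightarrow> 'f fm \<Rightarrow> bool" where
  "sat U F \<rho> (Eq s t) \<longleftrightarrow> val F \<rho> s = val F \<rho> t"
| "sat U F \<rho> Bot \<longleftrightarrow> False"
| "sat U F \<rho> (Imp \<phi> \<psi>) \<longleftrightarrow> (sat U F \<rho> \<phi> \<longrightarrow> sat U F \<rho> \<psi>)"
| "sat U F \<rho> (All \<phi>) \<longleftrightarrow> (\<forall>a\<in>U. sat U F (case_nat a \<rho>) \<phi>)"

lemma val_subst: "val F \<rho> (subst_trm s t) = val F (\<lambda>i. val F \<rho> (s i)) t"
  by (induction t) (auto intro: arg_cong[of _ _ "F _"])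

lemma sat_subst: "sat U F \<rho> (subst_fm s \<phi>) \<longleftrightarrow> sat U F (\<lambda>i. val F \<rho> (s i)) \<phi>"
proof (induction \<phi> arbitrary: \<rho> s)
  case (All \<phi>)
  have "(\<lambda>i. val F (case_nat a \<rho>) (case_nat (Var 0) (\<lambda>i. shift (s i)) i))
      = case_nat a (\<lambda>i. val F \<rho> (s i))" for a
    by (rule ext) (simp add: shift_def val_subst split: nat.split)
  with All show ?case by simp
qed (simp_all add: val_subst)

lemma sat_inst: "sat U F \<rho> (inst \<phi> t) \<longleftrightarrow> sat U F (case_nat (val F \<rho> t) \<rho>) \<phi>"
proof -
  have "(\<lambda>i. val F \<rho> (case_nat t Var i)) = case_nat (val F \<rho> t) \<rho>"
    by (rule ext) (simp split: nat.split)
  then show ?thesis by (simp add: inst_def sat_subst)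
qed

lemma sat_shift_fm: "sat U F (case_nat a \<rho>) (shift_fm \<phi>) \<longleftrightarrow> sat U F \<rho> \<phi>"
  by (simp add: shift_fm_def sat_subst)

lemma sat_Conj: "sat U F \<rho> (Conj \<phi>s) \<longleftrightarrow> (\<forall>\<phi>\<in>set \<phi>s. sat U F \<rho> \<phi>)"
  by (induction \<phi>s) (auto simp: Conj_def)

definition closed_under :: "'f lang \<Rightarrow> 'u set \<Rightarrow> ('f \<Rightarrow> 'u list \<Rightarrow> 'u) \<Rightarrow> bool" where
  "closed_under L U F \<longleftrightarrow> (\<forall>f us. L f = Some (length us) \<longrightarrow> set us \<subseteq> U \<longrightarrow> F f us \<in> U)"

lemma val_closed:
  "closed_under L U F \<Longrightarrow> lang_trm L t \<Longrightarrow> range \<rho> \<subseteq> U \<Longrightarrow> val F \<rho> t \<in> U"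
proof (induction t)
  case (Fun f ts)
  then show ?case
    unfolding closed_under_def by (auto simp: image_subset_iff)
qed auto

text \<open>The only rule that needs values to stay inside \<open>U\<close> is instantiation, which puts the value of
  a term in place of a quantified variable.\<close>

lemma derives_sound:
  assumes "derives L \<Gamma> \<phi>" and "closed_under L U F"
    and "range \<rho> \<subseteq> U" and "\<forall>\<psi>\<in>\<Gamma>. sat U F \<rho> \<psi>"
  shows "sat U F \<rho> \<phi>"
  using assms(1,3,4)
proof (induction arbitrary: \<rho>)
  case (AllI \<Gamma> \<phi>)
  have "sat U F (case_nat a \<rho>) \<phi>" if "a \<in> U" for a
  proof (rule AllI.IH)
    show "range (case_nat a \<rho>) \<subseteq> U"
      using that AllI.prems(1) by (auto simp: image_subset_iff split: nat.split)
    show "\<forall>\<psi>\<in>shift_fm ` \<Gamma>. sat U F (case_nat a \<rho>) \<psi>"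
      using AllI.prems(2) by (auto simp: sat_shift_fm)
  qed
  then show ?case by simp
next
  case (AllE \<Gamma> \<phi> t)
  have "sat U F \<rho> (All \<phi>)" using AllE.IH AllE.prems by blast
  then show ?case
    using val_closed[OF assms(2) AllE.hyps(2) AllE.prems(1)] by (simp add: sat_inst)
next
  case (EqE \<Gamma> s t \<phi>)
  then show ?case by (auto simp: sat_inst)
next
  case (ImpE \<Gamma> \<phi> \<psi>)
  then show ?case by auto
next
  case (Contr \<phi> \<Gamma>)
  then show ?case by auto
qed auto

text \<open>The tuple \<open>p\<close> continued by \<open>\<rho>\<close>: the assignment reached from \<open>\<rho>\<close> by entering \<open>length p\<close>
  quantifiers.\<close>

definition env :: "'u list \<Rightarrow> (nat \<Rightarrow> 'u) \<Rightarrow> nat \<Rightarrow> 'u" where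
  "env p \<rho> i = (if i < length p then p ! i else \<rho> (i - length p))"

lemma sat_All_power:
  "sat U F \<rho> ((All ^^ m) \<phi>) \<longleftrightarrow> (\<forall>p. length p = m \<and> set p \<subseteq> U \<longrightarrow> sat U F (env p \<rho>) \<phi>)"
proof (induction m arbitrary: \<rho>)
  case 0
  have "env [] \<rho> = \<rho>" by (simp add: env_def fun_eq_iff)
  then show ?case by simp
next
  case (Suc m)
  have snoc: "env p (case_nat a \<rho>) = env (p @ [a]) \<rho>" for p a
    \<comment> \<open>The outermost quantifier binds the variable of largest index.\<close>
    by (rule ext) (auto simp: env_def nth_append not_less_eq not_less le_Suc_eq Suc_diff_le
        split: nat.split intro!: arg_cong[of _ _ \<rho>])
  have "sat U F \<rho> ((All ^^ Suc m) \<phi>) \<longleftrightarrow>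
      (\<forall>a\<in>U. \<forall>p. length p = m \<and> set p \<subseteq> U \<longrightarrow> sat U F (env (p @ [a]) \<rho>) \<phi>)"
    by (simp add: Suc snoc)
  also have "\<dots> \<longleftrightarrow> (\<forall>q. length q = Suc m \<and> set q \<subseteq> U \<longrightarrow> sat U F (env q \<rho>) \<phi>)"
    by (auto simp: length_Suc_conv_rev)
  finally show ?case .
qed

section \<open>Embeddings preserve open formulas\<close>

lemma those_eq_Some_iff: "those xs = Some ys \<longleftrightarrow> xs = map Some ys"
  by (induction xs arbitrary: ys) (auto split: option.splits simp: Cons_eq_map_conv)

definition total_op :: "('f, 'a) palg \<Rightarrow> 'f \<Rightarrow> 'a list \<Rightarrow> 'a" where
  "total_op Q f us = the (oper Q f us)"

lemma val_embedding:
  assumes "embedding L P Q \<alpha>"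
  shows "eval P p t = Some a \<Longrightarrow> lang_trm L t \<Longrightarrow> val (total_op Q) (env (map \<alpha> p) \<rho>) t = \<alpha> a"
proof (induction t arbitrary: a)
  case (Var i)
  then show ?case by (auto simp: env_def split: if_splits)
next
  case (Fun f ts)
  then obtain as where as: "map (eval P p) ts = map Some as" "oper P f as = Some a"
    by (auto simp: bind_eq_Some_conv those_eq_Some_iff)
  have "map (val (total_op Q) (env (map \<alpha> p) \<rho>)) ts = map \<alpha> as"
  proof (rule nth_equalityI)
    show "length (map (val (total_op Q) (env (map \<alpha> p) \<rho>)) ts) = length (map \<alpha> as)"
      using as(1) by (metis length_map)
  next
    fix i assume "i < length (map (val (total_op Q) (env (map \<alpha> p) \<rho>)) ts)"
    then have i: "i < length ts" "i < length as" using as(1) by (auto dest: map_eq_imp_length_eq)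
    then have "eval P p (ts ! i) = Some (as ! i)" using as(1) by (metis nth_map)
    then show "map (val (total_op Q) (env (map \<alpha> p) \<rho>)) ts ! i = map \<alpha> as ! i"
      using Fun.IH[of "ts ! i"] Fun.prems(2) i by simp
  qed
  moreover have "oper Q f (map \<alpha> as) = Some (\<alpha> a)"
    using assms as(2) Fun.prems(2) unfolding embedding_def
    by (metis (no_types, lifting) domI lang_trm.simps(2) option.map(2))
  ultimately show ?case unfolding val.simps by (simp only: total_op_def option.sel)
qed

lemma eval_in_univ:
  assumes "partial_algebra L P" and "set p \<subseteq> univ P"
  shows "eval P p t = Some a \<Longrightarrow> lang_trm L t \<Longrightarrow> a \<in> univ P"
proof (cases t)
  case (Fun f ts)
  assume "eval P p t = Some a" "lang_trm L t"
  then obtain as where "oper P f as = Some a" and "L f = Some (length ts)"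
    using Fun by (auto simp: bind_eq_Some_conv)
  then show ?thesis
    using assms(1) unfolding partial_algebra_def by (meson ranI subsetD)
qed (use assms(2) in \<open>auto split: if_splits\<close>)

text \<open>For equations, one direction is preservation of values and the other is injectivity; since the
  terms of \<open>\<phi>\<close> are defined, both directions are available and pass through implication.  The
  identity on a total algebra is an embedding, so this also relates the two notions of truth
  in a total algebra.\<close>

lemma holds_iff_sat:
  assumes "partial_algebra L P" and "embedding L P Q \<alpha>" and "set p \<subseteq> univ P"
  shows "quantifier_free \<phi> \<Longrightarrow> lang_fm L \<phi> \<Longrightarrow> \<forall>t\<in>terms_of \<phi>. eval P p t \<noteq> None \<Longrightarrow>
    holds P p \<phi> \<longleftrightarrow> sat U (total_op Q) (env (map \<alpha> p) \<rho>) \<phi>"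
proof (induction \<phi>)
  case (Eq s t)
  then obtain a b where ab: "eval P p s = Some a" "eval P p t = Some b" by auto
  have "a \<in> univ P" "b \<in> univ P"
    using ab Eq.prems eval_in_univ[OF assms(1,3)] by auto
  moreover have "inj_on \<alpha> (univ P)" using assms(2) by (simp add: embedding_def)
  ultimately have "a = b \<longleftrightarrow> \<alpha> a = \<alpha> b" by (simp add: inj_on_eq_iff)
  with ab Eq.prems show ?case by (auto simp: val_embedding[OF assms(2)])
qed auto

lemma total_eval:
  assumes "total_algebra L Q" and "p \<in> tuples Q m"
  shows "lang_trm L t \<Longrightarrow> \<forall>i\<in>vars t. i < m \<Longrightarrow> \<exists>a\<in>univ Q. eval Q p t = Some a"
proof (induction t)
  case (Var i)
  then show ?case using assms(2) by (auto simp: tuples_def subset_iff)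
next
  case (Fun f ts)
  then have "\<forall>t\<in>set ts. \<exists>a. a \<in> univ Q \<and> eval Q p t = Some a" by (simp, blast)
  then obtain g where g: "\<forall>t\<in>set ts. g t \<in> univ Q \<and> eval Q p t = Some (g t)" by metis
  then have "those (map (eval Q p) ts) = Some (map g ts)" by (simp add: those_eq_Some_iff)
  moreover have "map g ts \<in> tuples Q (length ts)" using g by (auto simp: tuples_def)
  moreover have "dom (oper Q f) = tuples Q (length ts)" "ran (oper Q f) \<subseteq> univ Q"
    using assms(1) Fun.prems(1) by (auto simp: total_algebra_def partial_algebra_def)
  ultimately show ?case by (fastforce simp: ran_def)
qed

lemma Dom_total:
  assumes "total_algebra L Q" and "wf_fm L m \<omega>" and "quantifier_free \<omega>"
  shows "Dom Q m \<omega> = tuples Q m"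
proof -
  have "eval Q p t \<noteq> None" if "p \<in> tuples Q m" "t \<in> terms_of \<omega>" for p t
    using total_eval[OF assms(1) that(1)] wf_terms_of[OF assms(3,2) that(2)] by force
  then show ?thesis by (auto simp: Dom_def)
qed

lemma Mod_sat_sentence:
  assumes "Q \<in> Mod L \<Sigma>" and "\<sigma> \<in> \<Sigma>" and "universal_horn L \<sigma>"
  shows "sat (univ Q) (total_op Q) \<rho> (sentence \<sigma>)"
proof (cases \<sigma>)
  case (Univ m \<omega>)
  have Q: "total_algebra L Q" "satisfies Q \<sigma>" using assms(1,2) by (auto simp: Mod_def)
  have \<omega>: "wf_fm L m \<omega>" "quantifier_free \<omega>"
    using assms(3) Univ by (auto intro: quantifier_free_horn)
  have id_emb: "embedding L Q Q id" by (simp add: embedding_def option.map_id)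
  have "sat (univ Q) (total_op Q) (env p \<rho>) \<omega>" if "length p = m" "set p \<subseteq> univ Q" for p
  proof -
    have p: "p \<in> Dom Q m \<omega>"
      using that Dom_total[OF Q(1) \<omega>] by (auto simp: tuples_def)
    then have "holds Q p \<omega>" using Q(2) Univ by auto
    then show ?thesis
      using holds_iff_sat[OF _ id_emb that(2) \<omega>(2)] p \<omega>(1) Q(1)
      by (auto simp: Dom_def wf_fm_def total_algebra_def)
  qed
  then show ?thesis by (simp add: Univ sat_All_power)
qed

text \<open>Everything is moved to \<open>Q\<close>: there \<open>\<delta>\<close> is true at the images of the entries of a tuple of \<open>P\<close>,
  soundness gives \<open>\<omega>\<close> at the image of the tuple, and \<open>\<omega>\<close> is reflected back to \<open>P\<close>.\<close>

lemma relativized_consequence_holds: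
  fixes P :: "('f, 'a) palg" and Q :: "('f, 'u) palg"
  assumes P: "partial_algebra L P"
    and \<Sigma>: "\<forall>\<sigma>\<in>\<Sigma>. universal_horn L \<sigma>"
    and \<delta>: "quantifier_free \<delta>" "lang_fm L \<delta>" "satisfies P (Univ 1 \<delta>)" "Dom P 1 \<delta> = tuples P 1"
    and Q: "Q \<in> Mod L \<Sigma>" and emb: "embedding L P Q \<alpha>"
    and \<sigma>: "universal_horn L \<sigma>" and der: "derives L (sentence ` \<Sigma>) (sentence (relativize \<delta> \<sigma>))"
  shows "satisfies P \<sigma>"
proof (cases \<sigma>)
  case (Univ m \<omega>)
  have "holds P p \<omega>" if p: "p \<in> Dom P m \<omega>" for p
  proof -
    let ?U = "univ Q" and ?F = "total_op Q"
    have pm: "length p = m" "set p \<subseteq> univ P" using p by (auto simp: Dom_def tuples_def)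
    \<comment> \<open>The models are nonempty, so there is an assignment even when the tuple is empty.\<close>
    obtain u where u: "u \<in> ?U" using Q by (auto simp: Mod_def)
    have closed: "closed_under L ?U ?F"
      unfolding closed_under_def
    proof (intro allI impI)
      fix f us assume "L f = Some (length us)" "set us \<subseteq> ?U"
      then have "us \<in> dom (oper Q f)" "ran (oper Q f) \<subseteq> ?U"
        using Q by (auto simp: Mod_def total_algebra_def partial_algebra_def tuples_def)
      then show "?F f us \<in> ?U" by (auto simp: total_op_def ran_def)
    qed
    have "sat ?U ?F (\<lambda>_. u) (sentence (relativize \<delta> \<sigma>))"
      using derives_sound[OF der closed, of "\<lambda>_. u"] u Mod_sat_sentence[OF Q] \<Sigma> by auto
    moreover have "set (map \<alpha> p) \<subseteq> ?U"
      using pm emb by (auto simp: embedding_def)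
    ultimately have imp: "(\<forall>i<m. sat ?U ?F (env (map \<alpha> p) (\<lambda>_. u)) (subst_fm (\<lambda>_. Var i) \<delta>))
        \<longrightarrow> sat ?U ?F (env (map \<alpha> p) (\<lambda>_. u)) \<omega>"
      using pm by (auto simp: Univ sat_All_power sat_Conj)
    have "sat ?U ?F (env (map \<alpha> p) (\<lambda>_. u)) (subst_fm (\<lambda>_. Var i) \<delta>)" if "i < m" for i
    proof -
      have pi: "[p ! i] \<in> Dom P 1 \<delta>" "set [p ! i] \<subseteq> univ P"
        using pm that \<delta>(4) by (auto simp: tuples_def)
      then have "holds P [p ! i] \<delta>" using \<delta>(3) by auto
      \<comment> \<open>Continuing the one-element tuple by its own element gives a constant assignment, which
        is the one produced by substituting \<open>Var i\<close> for every variable of \<open>\<delta>\<close>.\<close>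
      then have "sat ?U ?F (env (map \<alpha> [p ! i]) (\<lambda>_. \<alpha> (p ! i))) \<delta>"
        using holds_iff_sat[OF P emb pi(2) \<delta>(1,2)] pi(1) by (auto simp: Dom_def)
      moreover have "env (map \<alpha> [p ! i]) (\<lambda>_. \<alpha> (p ! i)) = (\<lambda>_. \<alpha> (p ! i))"
        by (simp add: env_def fun_eq_iff)
      ultimately show ?thesis using that pm by (simp add: sat_subst env_def)
    qed
    with imp have "sat ?U ?F (env (map \<alpha> p) (\<lambda>_. u)) \<omega>" by blast
    then show ?thesis
      using holds_iff_sat[OF P emb pm(2), of \<omega>] \<sigma> p
      by (auto simp: Univ quantifier_free_horn Dom_def wf_fm_def)
  qed
  then show ?thesis by (simp add: Univ)
qed

text \<open>The type \<open>'u\<close> is arbitrary here, so embeddability into models over any type yields the laws; the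
  construction in the other direction then provides models made of terms.\<close>

corollary relativized_consequence_law:
  fixes L :: "'f lang" and \<P> :: "('f, 'a) palg set"
  assumes "\<forall>P\<in>\<P>. partial_algebra L P" and "\<forall>\<sigma>\<in>\<Sigma>. universal_horn L \<sigma>"
    and "quantifier_free \<delta>" "lang_fm L \<delta>" "law \<P> (Univ 1 \<delta>)" "total_for \<P> 1 \<delta>"
    and emb: "embeds_into_Mod TYPE('u) L \<P> \<Sigma>"
    and "universal_horn L \<sigma>" "derives L (sentence ` \<Sigma>) (sentence (relativize \<delta> \<sigma>))"
  shows "law \<P> \<sigma>"
  unfolding law_def
proof
  fix P assume P: "P \<in> \<P>"
  then obtain Q :: "('f, 'u) palg" and \<alpha> where Q: "Q \<in> Mod L \<Sigma>" "embedding L P Q \<alpha>"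
    using emb unfolding embeds_into_Mod_def by blast
  have "partial_algebra L P" "satisfies P (Univ 1 \<delta>)" "Dom P 1 \<delta> = tuples P 1"
    using P assms(1,5,6) by (simp_all add: law_def total_for_def del: satisfies.simps)
  from relativized_consequence_holds[OF this(1) assms(2,3,4) this(2,3) Q assms(8,9)]
  show "satisfies P \<sigma>" .
qed

section \<open>Natural deduction\<close>

lemma derives_weaken: "derives L \<Gamma> \<phi> \<Longrightarrow> \<Gamma> \<subseteq> \<Delta> \<Longrightarrow> derives L \<Delta> \<phi>"
proof (induction arbitrary: \<Delta> rule: derives.induct)
  case (AllI \<Gamma> \<phi>)
  then show ?case by (meson derives.AllI image_mono)
next
  case (ImpI \<phi> \<Gamma> \<psi>)
  then show ?case by (meson derives.ImpI insert_mono)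
next
  case (Contr \<phi> \<Gamma>)
  then show ?case by (meson derives.Contr insert_mono)
next
  case (Assm \<phi> \<Gamma>)
  then show ?case by (meson derives.Assm subsetD)
next
  case (ImpE \<Gamma> \<phi> \<psi>)
  then show ?case by (meson derives.ImpE)
next
  case (AllE \<Gamma> \<phi> t)
  then show ?case by (meson derives.AllE)
next
  case (EqI t \<Gamma>)
  then show ?case by (meson derives.EqI)
next
  case (EqE \<Gamma> s t \<phi>)
  then show ?case by (meson derives.EqE)
qed

lemma derives_cut: "lang_fm L \<phi> \<Longrightarrow> derives L \<Gamma> \<phi> \<Longrightarrow> derives L (insert \<phi> \<Gamma>) \<psi> \<Longrightarrow> derives L \<Gamma> \<psi>"
  by (blast intro: derives.ImpI derives.ImpE)

lemma derives_ex_falso: "lang_fm L \<phi> \<Longrightarrow> derives L \<Gamma> Bot \<Longrightarrow> derives L \<Gamma> \<phi>"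
  by (rule derives.Contr) (auto intro: derives_weaken)

lemma derives_insert: "derives L \<Gamma> \<phi> \<Longrightarrow> derives L (insert \<psi> \<Gamma>) \<phi>"
  by (rule derives_weaken) auto

lemma derives_insertI: "derives L (insert \<phi> \<Gamma>) \<phi>"
  by (simp add: derives.Assm)

lemma derives_AndE1:
  assumes "lang_fm L \<phi>" "lang_fm L \<psi>" "derives L \<Gamma> (And \<phi> \<psi>)"
  shows "derives L \<Gamma> \<phi>"
proof (rule derives.Contr[OF assms(1)])
  have "derives L (insert \<phi> (insert (Neg \<phi>) \<Gamma>)) Bot"
    by (rule derives.ImpE[of _ _ \<phi>]) (simp_all add: derives.Assm)
  then have "derives L (insert \<phi> (insert (Neg \<phi>) \<Gamma>)) (Neg \<psi>)"
    by (rule derives_ex_falso[rotated]) (simp add: assms)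
  then have "derives L (insert (Neg \<phi>) \<Gamma>) (Imp \<phi> (Neg \<psi>))"
    by (rule derives.ImpI[OF assms(1)])
  then show "derives L (insert (Neg \<phi>) \<Gamma>) Bot"
    by (rule derives.ImpE[OF derives_insert[OF assms(3)]])
qed

lemma derives_AndE2:
  assumes "lang_fm L \<phi>" "lang_fm L \<psi>" "derives L \<Gamma> (And \<phi> \<psi>)"
  shows "derives L \<Gamma> \<psi>"
proof (rule derives.Contr[OF assms(2)])
  have "derives L (insert (Neg \<psi>) \<Gamma>) (Imp \<phi> (Neg \<psi>))"
    by (rule derives.ImpI[OF assms(1)]) (simp add: derives.Assm)
  then show "derives L (insert (Neg \<psi>) \<Gamma>) Bot"
    by (rule derives.ImpE[OF derives_insert[OF assms(3)]])
qed

lemma derives_ConjE: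
  "derives L \<Gamma> (Conj \<phi>s) \<Longrightarrow> lang_fm L (Conj \<phi>s) \<Longrightarrow> \<phi> \<in> set \<phi>s \<Longrightarrow> derives L \<Gamma> \<phi>"
proof (induction \<phi>s)
  case (Cons \<psi> \<psi>s)
  have d: "derives L \<Gamma> (And \<psi> (Conj \<psi>s))" and l: "lang_fm L \<psi>" "lang_fm L (Conj \<psi>s)"
    using Cons.prems by (simp_all add: Conj_def)
  show ?case
  proof (cases "\<phi> = \<psi>")
    case True
    then show ?thesis using derives_AndE1[OF l d] by simp
  next
    case False
    then have "\<phi> \<in> set \<psi>s" using Cons.prems(3) by simp
    then show ?thesis by (rule Cons.IH[OF derives_AndE2[OF l d] l(2)])
  qed
qed simp

lemma derives_Conj_single:
  assumes "lang_fm L \<phi>" "derives L \<Gamma> \<phi>"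
  shows "derives L \<Gamma> (Conj [\<phi>])"
proof -
  let ?\<Delta> = "insert (Imp \<phi> (Neg Top)) \<Gamma>"
  have "derives L ?\<Delta> (Neg Top)"
    by (rule derives.ImpE[OF derives_insertI derives_insert[OF assms(2)]])
  moreover have "derives L ?\<Delta> Top"
    by (rule derives.ImpI) (simp_all add: derives_insertI)
  ultimately have "derives L ?\<Delta> Bot" by (rule derives.ImpE)
  then have "derives L \<Gamma> (And \<phi> Top)"
    by (rule derives.ImpI[rotated]) (simp add: assms(1))
  then show ?thesis by (simp add: Conj_def)
qed

lemma derives_DisjE:
  assumes "derives L \<Gamma> (Disj \<phi>s)" "lang_fm L (Disj \<phi>s)" "lang_fm L \<chi>"
    and "\<And>\<phi>. \<phi> \<in> set \<phi>s \<Longrightarrow> derives L (insert \<phi> \<Gamma>) \<chi>"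
  shows "derives L \<Gamma> \<chi>"
  using assms
proof (induction \<phi>s arbitrary: \<Gamma>)
  case Nil
  then have "derives L \<Gamma> Bot" by (simp add: Disj_def)
  then show ?case by (rule derives_ex_falso[OF Nil.prems(3)])
next
  case (Cons \<psi> \<psi>s)
  have l: "lang_fm L \<psi>" "lang_fm L (Disj \<psi>s)" using Cons.prems(2) by (simp_all add: Disj_def)
  have d: "derives L \<Gamma> (Imp (Neg \<psi>) (Disj \<psi>s))" using Cons.prems(1) by (simp add: Disj_def)
  let ?\<Delta> = "insert (Neg \<chi>) \<Gamma>"
  have "derives L (insert \<psi> ?\<Delta>) \<chi>"
    using Cons.prems(4)[of \<psi>] by (rule derives_weaken) auto
  then have "derives L (insert \<psi> ?\<Delta>) Bot"
    by (rule derives.ImpE[rotated]) (simp add: derives.Assm)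
  then have "derives L ?\<Delta> (Neg \<psi>)" by (rule derives.ImpI[OF l(1)])
  then have "derives L ?\<Delta> (Disj \<psi>s)"
    by (rule derives.ImpE[OF derives_insert[OF d]])
  moreover have "derives L (insert \<phi> ?\<Delta>) \<chi>" if "\<phi> \<in> set \<psi>s" for \<phi>
    by (rule derives_weaken[OF Cons.prems(4)[of \<phi>]]) (use that in auto)
  ultimately have "derives L ?\<Delta> \<chi>" by (rule Cons.IH[OF _ l(2) Cons.prems(3)])
  then have "derives L ?\<Delta> Bot"
    by (rule derives.ImpE[OF derives_insertI])
  then show ?case by (rule derives.Contr[OF Cons.prems(3)])
qed

text \<open>A deduction theorem in clausal form: each discharged hypothesis becomes a negated literal.\<close>

lemma derives_clauseI:
  assumes "\<forall>\<phi>\<in>set \<phi>s. lang_fm L \<phi>" and "derives L (\<Gamma> \<union> set \<phi>s) (Disj \<psi>s)"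
  shows "derives L \<Gamma> (Disj (map Neg \<phi>s @ \<psi>s))"
  using assms
proof (induction \<phi>s arbitrary: \<Gamma>)
  case (Cons \<phi> \<phi>s)
  let ?\<Delta> = "insert (Neg (Neg \<phi>)) \<Gamma>" and ?C = "Disj (map Neg \<phi>s @ \<psi>s)"
  have l: "lang_fm L \<phi>" using Cons.prems(1) by simp
  have "derives L (insert \<phi> \<Gamma>) ?C"
    using Cons by simp
  then have "derives L (insert \<phi> ?\<Delta>) ?C" by (rule derives_weaken) auto
  moreover have "derives L ?\<Delta> \<phi>"
    by (rule derives.Contr[OF l]) (rule derives.ImpE[of _ _ "Neg \<phi>"]; simp add: derives.Assm)
  ultimately have "derives L ?\<Delta> ?C" using l by (blast intro: derives_cut)
  then show ?case using l by (simp add: Disj_def derives.ImpI)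
qed simp

text \<open>Shifting leaves closed hypotheses unchanged, so the eigenvariable condition is vacuous.\<close>

lemma derives_All_powerI:
  assumes "\<forall>\<psi>\<in>\<Gamma>. free_below 0 \<psi>" and "derives L \<Gamma> \<phi>"
  shows "derives L \<Gamma> ((All ^^ m) \<phi>)"
proof (induction m)
  case (Suc m)
  have "shift_fm ` \<Gamma> = \<Gamma>" using assms(1) by (simp add: shift_fm_closed)
  then show ?case using Suc by (simp add: derives.AllI)
qed (simp add: assms)

text \<open>The substitution \<open>s\<close> records the instances already chosen for the outer quantifiers; it has to be
  arbitrary for the induction, which strips the quantifiers from the outside.\<close>

lemma derives_All_powerE:
  assumes "derives L \<Gamma> (subst_fm s ((All ^^ m) \<phi>))" and "\<And>i. i < m \<Longrightarrow> lang_trm L (t i)"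
  shows "derives L \<Gamma> (subst_fm (\<lambda>i. if i < m then t i else s (i - m)) \<phi>)"
  using assms
proof (induction m arbitrary: s)
  case (Suc m)
  let ?r = "case_nat (t m) s"
  have "(\<lambda>i. subst_trm (case_nat (t m) Var) (case_nat (Var 0) (\<lambda>i. shift (s i)) i)) = ?r"
    by (rule ext) (simp add: subst_trm_shift subst_trm_Var split: nat.split)
  then have "inst (subst_fm (case_nat (Var 0) (\<lambda>i. shift (s i))) ((All ^^ m) \<phi>)) (t m)
      = subst_fm ?r ((All ^^ m) \<phi>)"
    by (simp add: inst_def subst_fm_subst_fm)
  moreover have "derives L \<Gamma> (All (subst_fm (case_nat (Var 0) (\<lambda>i. shift (s i))) ((All ^^ m) \<phi>)))"
    using Suc.prems(1) by simp
  ultimately have "derives L \<Gamma> (subst_fm ?r ((All ^^ m) \<phi>))"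
    using derives.AllE[of L \<Gamma> _ "t m"] Suc.prems(2) by (metis lessI)
  then have "derives L \<Gamma> (subst_fm (\<lambda>i. if i < m then t i else ?r (i - m)) \<phi>)"
    by (rule Suc.IH) (simp add: Suc.prems(2))
  moreover have "(\<lambda>i. if i < m then t i else ?r (i - m))
      = (\<lambda>i. if i < Suc m then t i else s (i - Suc m))"
    by (rule ext) (auto simp: less_Suc_eq not_less split: nat.split intro!: arg_cong[of _ _ s])
  ultimately show ?case by simp
qed simp

lemma derives_instance:
  assumes "derives L \<Gamma> ((All ^^ m) \<phi>)" "free_below m \<phi>" "\<And>i. i < m \<Longrightarrow> lang_trm L (t i)"
  shows "derives L \<Gamma> (subst_fm t \<phi>)"
proof -
  have "derives L \<Gamma> (subst_fm (\<lambda>i. if i < m then t i else Var (i - m)) \<phi>)"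
    using derives_All_powerE[of L \<Gamma> Var m \<phi> t] assms(1,3) by (simp add: subst_fm_Var)
  also have "subst_fm (\<lambda>i. if i < m then t i else Var (i - m)) \<phi> = subst_fm t \<phi>"
    by (rule subst_fm_cong[OF assms(2)]) simp
  finally show ?thesis .
qed

lemma derives_sym:
  assumes "derives L \<Gamma> (Eq s t)" "lang_trm L s"
  shows "derives L \<Gamma> (Eq t s)"
proof -
  have "inst (Eq (Var 0) (shift s)) u = Eq u s" for u
    by (simp add: inst_def subst_trm_shift subst_trm_Var)
  then show ?thesis
    using derives.EqE[OF assms(1), of "Eq (Var 0) (shift s)"] derives.EqI[OF assms(2)] by simp
qed

lemma derives_trans:
  assumes "derives L \<Gamma> (Eq s t)" "derives L \<Gamma> (Eq t u)"
  shows "derives L \<Gamma> (Eq s u)"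
proof -
  have "inst (Eq (shift s) (Var 0)) v = Eq s v" for v
    by (simp add: inst_def subst_trm_shift subst_trm_Var)
  then show ?thesis
    using derives.EqE[OF assms(2), of "Eq (shift s) (Var 0)"] assms(1) by simp
qed

text \<open>The arguments are replaced one at a time, the prefix \<open>vs\<close> of the argument list being unaffected.\<close>

lemma derives_congruence:
  assumes "list_all2 (\<lambda>t u. derives L \<Gamma> (Eq t u)) ts us" and "lang_trm L (Fun f ts)"
  shows "derives L \<Gamma> (Eq (Fun f ts) (Fun f us))"
proof -
  \<comment> \<open>The replacement goes from right to left, so the arguments in \<open>vs\<close> are still the old ones.\<close>
  have "derives L \<Gamma> (Eq (Fun f (vs @ ts)) (Fun f (vs @ us)))" if "lang_trm L (Fun f (vs @ ts))" for vs
    using assms(1) that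
  proof (induction ts us arbitrary: vs rule: list_all2_induct)
    case Nil
    then show ?case by (simp add: derives.EqI del: lang_trm.simps)
  next
    case (Cons t ts u us)
    let ?\<phi> = "Eq (shift (Fun f (vs @ t # ts))) (Fun f (map shift vs @ Var 0 # map shift us))"
    have "inst ?\<phi> w = Eq (Fun f (vs @ t # ts)) (Fun f (vs @ w # us))" for w
      by (simp add: inst_def subst_trm_shift subst_trm_Var comp_def del: subst_trm.simps(2))
         (simp add: subst_trm_shift subst_trm_Var comp_def)
    moreover have "derives L \<Gamma> (Eq (Fun f (vs @ t # ts)) (Fun f (vs @ t # us)))"
      using Cons.IH[of "vs @ [t]"] Cons.prems by simp
    ultimately show ?case
      using derives.EqE[OF Cons.hyps(1), of ?\<phi>] by simp
  qed
  from this[of "[]"] assms(2) show ?thesis by simp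
qed

section \<open>The algebra presented by the diagram\<close>

text \<open>The last assumption is about derivability of the open formula, without relativization;
  \<open>derives_relativize\<close> below obtains it from laws whose relativizations are derivable.\<close>

locale presentation =
  fixes L :: "'f lang" and \<Sigma> :: "'f usent set" and P :: "('f, 'a) palg"
  assumes partial: "partial_algebra L P"
    and horn: "\<sigma> \<in> \<Sigma> \<Longrightarrow> universal_horn L \<sigma>"
    and derivable_satisfied:
      "universal_horn L (Univ m \<omega>) \<Longrightarrow> derives L (sentence ` \<Sigma>) \<omega> \<Longrightarrow> satisfies P (Univ m \<omega>)"
begin

definition diagram :: "('f \<times> 'a list) set" where
  "diagram = {(f, p). f \<in> dom L \<and> p \<in> dom (oper P f)}"

text \<open>Formulas have only countably many variables, while \<open>P\<close> may be of any size.  Elements of \<open>P\<close>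
  therefore enter formulas through a naming \<open>e\<close>, which can be one-to-one on any finite set of
  elements that matters but not in general on all of \<open>P\<close>.\<close>

fun entry :: "('a \<Rightarrow> nat) \<Rightarrow> 'f \<times> 'a list \<Rightarrow> 'f fm" where
  "entry e (f, p) = Eq (Fun f (map (\<lambda>a. Var (e a)) p)) (Var (e (the (oper P f p))))"

text \<open>Derivability from \<open>\<Sigma>\<close> and finitely many entries, for a statement \<open>\<phi> e\<close> about elements of \<open>P\<close>
  under the naming \<open>e\<close>.  One finite set of entries has to serve all namings: then finite sets
  used for several statements can be united before a naming is chosen.\<close>

definition forced :: "(('a \<Rightarrow> nat) \<Rightarrow> 'f fm) \<Rightarrow> bool" where
  "forced \<phi> \<longleftrightarrow> (\<exists>D. finite D \<and> D \<subseteq> diagram \<and>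
     (\<forall>e. derives L (sentence ` \<Sigma> \<union> entry e ` D) (\<phi> e)))"

text \<open>Any rule of inference with finitely many premises carries over from derivability to \<open>forced\<close>.\<close>

lemma forced_combine:
  assumes "finite I" and "\<And>i. i \<in> I \<Longrightarrow> forced (\<phi> i)"
    and step: "\<And>e \<Delta>. sentence ` \<Sigma> \<subseteq> \<Delta> \<Longrightarrow> (\<And>i. i \<in> I \<Longrightarrow> derives L \<Delta> (\<phi> i e)) \<Longrightarrow> derives L \<Delta> (\<psi> e)"
  shows "forced \<psi>"
proof -
  obtain D where D: "\<forall>i\<in>I. finite (D i) \<and> D i \<subseteq> diagram \<and>
      (\<forall>e. derives L (sentence ` \<Sigma> \<union> entry e ` D i) (\<phi> i e))"
    using assms(2) unfolding forced_def by metis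
  let ?D = "\<Union>i\<in>I. D i"
  have "derives L (sentence ` \<Sigma> \<union> entry e ` ?D) (\<psi> e)" for e
  proof (rule step)
    fix i assume "i \<in> I"
    with D have "derives L (sentence ` \<Sigma> \<union> entry e ` D i) (\<phi> i e)" by blast
    then show "derives L (sentence ` \<Sigma> \<union> entry e ` ?D) (\<phi> i e)"
      by (rule derives_weaken) (use \<open>i \<in> I\<close> in blast)
  qed blast
  moreover have "finite ?D" "?D \<subseteq> diagram" using D assms(1) by auto
  ultimately show ?thesis unfolding forced_def by blast
qed

text \<open>The list \<open>gs\<close> has at most one element, so this treats at once an equation between two elements
  and, for the empty list, falsity, which then cannot be forced.  The finitely many elements in
  play are listed as \<open>xs\<close> and named by their positions in \<open>xs\<close>.  For this naming the derivation
  becomes one of a single Horn clause, to be evaluated in \<open>P\<close> at the tuple \<open>xs\<close>.\<close>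

lemma forced_equation_holds:
  assumes "forced (\<lambda>e. Disj (map (\<lambda>(a, b). Eq (Var (e a)) (Var (e b))) gs))"
    and "length gs \<le> 1" and "set gs \<subseteq> univ P \<times> univ P"
  shows "\<exists>(a, b)\<in>set gs. a = b"
proof -
  obtain D where D: "finite D" "D \<subseteq> diagram"
    and der: "\<And>e. derives L (sentence ` \<Sigma> \<union> entry e ` D)
      (Disj (map (\<lambda>(a, b). Eq (Var (e a)) (Var (e b))) gs))"
    using assms(1) unfolding forced_def by blast
  \<comment> \<open>The elements occurring in the entries used or in the goal.\<close>
  define A where "A = (\<Union>(f, p)\<in>D. insert (the (oper P f p)) (set p)) \<union> fst ` set gs \<union> snd ` set gs"
  have args: "a \<in> A" if "(f, p) \<in> D" "a \<in> set p" for f p a using that by (auto simp: A_def)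
  have res: "the (oper P f p) \<in> A" if "(f, p) \<in> D" for f p using that by (auto simp: A_def)
  have goal_sides: "a \<in> A" "b \<in> A" if "(a, b) \<in> set gs" for a b using that by (force simp: A_def)+
  have D_univ: "L f = Some (length p) \<and> set p \<subseteq> univ P \<and> the (oper P f p) \<in> univ P
      \<and> oper P f p = Some (the (oper P f p))" if "(f, p) \<in> D" for f p
  proof -
    have "(f, p) \<in> diagram" using D(2) that by blast
    then obtain n b where "L f = Some n" "oper P f p = Some b" by (auto simp: diagram_def)
    then show ?thesis
      using partial unfolding partial_algebra_def tuples_def by (fastforce simp: ran_def dom_def)
  qed
  have A_univ: "A \<subseteq> univ P"
    unfolding A_def using D_univ assms(3) by (auto simp: subset_iff)
  have "finite A" using D(1) by (auto simp: A_def)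
  then obtain xs where xs: "set xs = A" using finite_list[of A] by blast
  obtain ds where ds: "set ds = D" using finite_list[OF D(1)] by blast
  define e where "e a = (SOME i. i < length xs \<and> xs ! i = a)" for a
  have e: "e a < length xs \<and> xs ! e a = a" if "a \<in> A" for a
    unfolding e_def by (rule someI_ex) (use that xs in \<open>metis in_set_conv_nth\<close>)
  let ?gs = "map (\<lambda>(a, b). Eq (Var (e a)) (Var (e b))) gs"
  let ?ls = "map Neg (map (entry e) ds) @ ?gs"
  let ?\<omega> = "Conj [Disj ?ls]"
  have lang_ds: "\<forall>\<phi>\<in>set (map (entry e) ds). lang_fm L \<phi>" using D_univ ds by auto
  have free_ds: "\<forall>\<phi>\<in>set (map (entry e) ds). free_below (length xs) \<phi>"
    using e args res ds by auto
  have free_gs: "\<forall>\<phi>\<in>set ?gs. free_below (length xs) \<phi>"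
    using e goal_sides by auto
  have lang_ls: "lang_fm L (Disj ?ls)" using lang_ds by (auto simp: lang_fm_Disj)
  have wf: "wf_fm L (length xs) ?\<omega>"
    using lang_ls free_ds free_gs
    by (auto simp: wf_fm_def lang_fm_Conj free_below_Conj free_below_Disj)
  have "filter atomic ?ls = filter atomic ?gs" by (auto simp: filter_empty_conv atomic_def)
  then have "length (filter atomic ?ls) \<le> 1"
    using assms(2) by (metis length_filter_le length_map order_trans)
  moreover have "\<forall>l\<in>set ?ls. atomic l \<or> negated_atomic l"
    by (auto simp: atomic_def negated_atomic_def)
  ultimately have "horn_clause (Disj ?ls)" unfolding horn_clause_def by blast
  then have "horn_formula ?\<omega>"
    unfolding horn_formula_def by (intro exI[of _ "[Disj ?ls]"]) simp
  with wf have "universal_horn L (Univ (length xs) ?\<omega>)" by simp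
  moreover have "derives L (sentence ` \<Sigma>) ?\<omega>"
    using derives_Conj_single[OF lang_ls derives_clauseI[OF lang_ds]] der ds by simp
  ultimately have sat: "satisfies P (Univ (length xs) ?\<omega>)" by (rule derivable_satisfied)
  have var: "eval P xs (Var (e a)) = Some a" if "a \<in> A" for a
    using e[OF that] by simp
  have fun_eval: "eval P xs (Fun f (map (\<lambda>a. Var (e a)) p)) = oper P f p" if "(f, p) \<in> D" for f p
  proof -
    have "map (eval P xs) (map (\<lambda>a. Var (e a)) p) = map Some p"
      using var args[OF that] by (simp del: eval.simps)
    then have "those (map (eval P xs) (map (\<lambda>a. Var (e a)) p)) = Some p"
      by (simp only: those_eq_Some_iff)
    then show ?thesis by (simp only: eval.simps Option.bind.bind_lunit)
  qed
  have "xs \<in> tuples P (length xs)" using A_univ xs by (simp add: tuples_def)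
  moreover have "eval P xs t \<noteq> None" if t: "t \<in> terms_of ?\<omega>" for t
  proof -
    consider f p where "(f, p) \<in> D" "t \<in> terms_of (entry e (f, p))"
      | a b where "(a, b) \<in> set gs" "t \<in> {Var (e a), Var (e b)}"
      using t ds by (auto simp: terms_of_Conj terms_of_Disj simp del: entry.simps)
    then show ?thesis
    proof cases
      case 1
      then have "t = Fun f (map (\<lambda>a. Var (e a)) p) \<or> t = Var (e (the (oper P f p)))" by simp
      then show ?thesis
        using fun_eval[OF 1(1)] var[OF res[OF 1(1)]] D_univ[OF 1(1)] by (metis option.distinct(1))
    next
      case 2
      then show ?thesis using var goal_sides by (auto simp del: eval.simps)
    qed
  qed
  ultimately have "holds P xs ?\<omega>" using sat by (auto simp: Dom_def)
  then have "holds P xs (Disj ?ls)" by (simp add: holds_Conj)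
  then obtain l where l: "l \<in> set ?ls" "holds P xs l" unfolding holds_Disj by blast
  \<comment> \<open>The entries are true at \<open>xs\<close>, so the true literal is not one of their negations.\<close>
  have "holds P xs (entry e d)" if "d \<in> D" for d
  proof (cases d)
    case (Pair f p)
    with that have fp: "(f, p) \<in> D" by simp
    show ?thesis
      using fun_eval[OF fp] var[OF res[OF fp]] D_univ[OF fp]
      by (simp only: Pair entry.simps holds.simps) blast
  qed
  with l ds have "l \<in> set ?gs" by (auto simp del: entry.simps)
  then obtain a b where ab: "(a, b) \<in> set gs" "l = Eq (Var (e a)) (Var (e b))" by auto
  then have "a = b" using l(2) var goal_sides by (auto simp del: eval.simps)
  with ab(1) show ?thesis by blast
qed

lemma not_forced_Bot: "\<not> forced (\<lambda>_. Bot)"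
  using forced_equation_holds[of "[]"] by (auto simp: Disj_def)

lemma forced_Var_eq:
  assumes "forced (\<lambda>e. Eq (Var (e a)) (Var (e b)))" "a \<in> univ P" "b \<in> univ P"
  shows "a = b"
proof -
  have "forced (\<lambda>e. Imp (Neg (Eq (Var (e a)) (Var (e b)))) Bot)"
  proof (rule forced_combine[of "{()}"])
    fix e \<Delta> assume "\<And>i. i \<in> {()} \<Longrightarrow> derives L \<Delta> (Eq (Var (e a)) (Var (e b)))"
    then show "derives L \<Delta> (Imp (Neg (Eq (Var (e a)) (Var (e b)))) Bot)"
      by (intro derives.ImpI derives.ImpE[OF derives_insertI derives_insert]) auto
  qed (use assms in auto)
  then have "forced (\<lambda>e. Disj (map (\<lambda>(a, b). Eq (Var (e a)) (Var (e b))) [(a, b)]))"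
    by (simp add: Disj_def)
  from forced_equation_holds[OF this] assms(2,3) show ?thesis by simp
qed

definition named :: "('a \<Rightarrow> nat) \<Rightarrow> ('f, 'a) trm \<Rightarrow> ('f, nat) trm" where
  "named e = subst_trm (\<lambda>a. Var (e a))"

lemma lang_trm_named: "lang_trm L t \<Longrightarrow> lang_trm L (named e t)"
  by (simp add: named_def lang_trm_subst)

text \<open>The congruence that defines the presented algebra.  The terms may contain variables from all of
  the type \<open>'a\<close>; those outside the universe of \<open>P\<close> are additional free generators, and
  they keep the algebra nonempty when \<open>P\<close> is empty and there are no constants.\<close>

definition eqv :: "('f, 'a) trm \<Rightarrow> ('f, 'a) trm \<Rightarrow> bool" where
  "eqv s t \<longleftrightarrow> lang_trm L s \<and> lang_trm L t \<and> forced (\<lambda>e. Eq (named e s) (named e t))"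

lemma eqv_refl: "lang_trm L t \<Longrightarrow> eqv t t"
  using forced_combine[of "{}"] by (simp add: eqv_def derives.EqI lang_trm_named)

lemma eqv_sym:
  assumes "eqv s t"
  shows "eqv t s"
proof -
  have "forced (\<lambda>e. Eq (named e t) (named e s))"
    by (rule forced_combine[of "{()}" "\<lambda>_ e. Eq (named e s) (named e t)"])
      (use assms in \<open>auto simp: eqv_def lang_trm_named intro: derives_sym\<close>)
  then show ?thesis using assms by (simp add: eqv_def)
qed

lemma eqv_trans:
  assumes "eqv s t" "eqv t u"
  shows "eqv s u"
proof -
  have "forced (\<lambda>e. Eq (named e s) (named e u))"
  proof (rule forced_combine[of "{(s, t), (t, u)}" "\<lambda>(v, w) e. Eq (named e v) (named e w)"])
    fix e \<Delta>
    assume "\<And>i. i \<in> {(s, t), (t, u)} \<Longrightarrow> derives L \<Delta> ((\<lambda>(v, w) e. Eq (named e v) (named e w)) i e)"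
    from this[of "(s, t)"] this[of "(t, u)"] show "derives L \<Delta> (Eq (named e s) (named e u))"
      by (auto intro: derives_trans)
  qed (use assms in \<open>auto simp: eqv_def\<close>)
  then show ?thesis using assms by (simp add: eqv_def)
qed

lemma eqv_congruence:
  assumes "L f = Some (length ts)" and "list_all2 eqv ts us"
  shows "eqv (Fun f ts) (Fun f us)"
proof -
  have len: "length us = length ts" using assms(2) by (simp add: list_all2_lengthD)
  have nth: "eqv (ts ! i) (us ! i)" if "i < length ts" for i
    using assms(2) that by (simp add: list_all2_conv_all_nth)
  have lang: "lang_trm L (Fun f ts)" "lang_trm L (Fun f us)"
    using nth len assms(1) by (auto simp: eqv_def in_set_conv_nth)
  have "forced (\<lambda>e. Eq (named e (Fun f ts)) (named e (Fun f us)))"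
  proof (rule forced_combine[of "{..<length ts}" "\<lambda>i e. Eq (named e (ts ! i)) (named e (us ! i))"])
    fix e \<Delta>
    assume "\<And>i. i \<in> {..<length ts} \<Longrightarrow> derives L \<Delta> (Eq (named e (ts ! i)) (named e (us ! i)))"
    then have "list_all2 (\<lambda>t u. derives L \<Delta> (Eq t u)) (map (named e) ts) (map (named e) us)"
      by (simp add: list_all2_conv_all_nth len)
    from derives_congruence[OF this, of f] lang_trm_named[OF lang(1), of e]
    show "derives L \<Delta> (Eq (named e (Fun f ts)) (named e (Fun f us)))"
      by (simp add: named_def)
  qed (use nth in \<open>auto simp: eqv_def\<close>)
  with lang show ?thesis by (simp add: eqv_def del: lang_trm.simps)
qed

lemma eqv_diagram:
  assumes "L f = Some (length p)" "oper P f p = Some b"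
  shows "eqv (Fun f (map Var p)) (Var b)"
proof -
  have "forced (\<lambda>e. Eq (named e (Fun f (map Var p))) (named e (Var b)))"
    unfolding forced_def
    by (rule exI[of _ "{(f, p)}"])
      (use assms in \<open>auto simp: diagram_def named_def comp_def intro: derives.Assm\<close>)
  then show ?thesis using assms by (auto simp: eqv_def)
qed

text \<open>The quotient is realized on representatives, so that its elements are again terms.\<close>

definition rep :: "('f, 'a) trm \<Rightarrow> ('f, 'a) trm" where
  "rep t = (SOME u. eqv t u)"

lemma eqv_rep: "lang_trm L t \<Longrightarrow> eqv t (rep t)"
  unfolding rep_def by (rule someI) (rule eqv_refl)

lemma rep_eq_iff:
  assumes "lang_trm L s" "lang_trm L t"
  shows "rep s = rep t \<longleftrightarrow> eqv s t"
proof
  assume "rep s = rep t"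
  then show "eqv s t" using eqv_rep assms eqv_sym eqv_trans by metis
next
  assume "eqv s t"
  then have "eqv s = eqv t" using eqv_sym eqv_trans by blast
  then show "rep s = rep t" by (simp add: rep_def)
qed

lemma lang_trm_rep: "lang_trm L t \<Longrightarrow> lang_trm L (rep t)"
  using eqv_rep by (simp add: eqv_def)

lemma rep_rep: "lang_trm L t \<Longrightarrow> rep (rep t) = rep t"
  by (simp add: rep_eq_iff lang_trm_rep eqv_rep eqv_sym)

lemma rep_Fun_rep:
  assumes "lang_trm L (Fun f ts)"
  shows "rep (Fun f (map rep ts)) = rep (Fun f ts)"
proof -
  have "list_all2 eqv ts (map rep ts)"
    using assms by (auto simp: list_all2_conv_all_nth intro: eqv_rep)
  then have "eqv (Fun f ts) (Fun f (map rep ts))" using assms eqv_congruence by simp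
  then show ?thesis by (metis eqv_def rep_eq_iff)
qed

definition model :: "('f, ('f, 'a) trm) palg" where
  "model = \<lparr>univ = rep ` {t. lang_trm L t},
     oper = (\<lambda>f us. if L f = Some (length us) \<and> set us \<subseteq> rep ` {t. lang_trm L t}
       then Some (rep (Fun f us)) else None)\<rparr>"

lemma univ_modelD: "u \<in> univ model \<Longrightarrow> lang_trm L u \<and> rep u = u"
  by (auto simp: model_def lang_trm_rep rep_rep)

lemma rep_in_model: "lang_trm L t \<Longrightarrow> rep t \<in> univ model"
  by (simp add: model_def)

lemma oper_model:
  "L f = Some (length us) \<Longrightarrow> set us \<subseteq> univ model \<Longrightarrow> oper model f us = Some (rep (Fun f us))"
  by (simp add: model_def)

lemma total_model: "total_algebra L model"
proof -
  have "dom (oper model f) = tuples model n" if "L f = Some n" for f n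
    using that by (auto simp: model_def tuples_def split: if_splits)
  moreover have "ran (oper model f) \<subseteq> univ model" if "L f = Some n" for f n
  proof
    fix b assume "b \<in> ran (oper model f)"
    then obtain us where us: "L f = Some (length us)" "set us \<subseteq> univ model" "b = rep (Fun f us)"
      by (auto simp: model_def ran_def split: if_splits)
    then have "lang_trm L (Fun f us)" using univ_modelD by auto
    with us(3) show "b \<in> univ model" by (simp add: rep_in_model del: lang_trm.simps)
  qed
  ultimately show ?thesis unfolding total_algebra_def partial_algebra_def by simp
qed

text \<open>Terms are evaluated by substitution, as in any quotient of a term algebra.\<close>

lemma eval_model:
  assumes "p \<in> tuples model m"
  shows "lang_trm L t \<Longrightarrow> \<forall>i\<in>vars t. i < m \<Longrightarrow>
    lang_trm L (subst_trm (\<lambda>i. p ! i) t) \<and> eval model p t = Some (rep (subst_trm (\<lambda>i. p ! i) t))"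
proof (induction t)
  case (Var i)
  then have "p ! i \<in> univ model" "i < length p" using assms by (auto simp: tuples_def subset_iff)
  then show ?case using univ_modelD by simp
next
  case (Fun f ts)
  let ?\<iota> = "subst_trm (\<lambda>i. p ! i)"
  have IH: "lang_trm L (?\<iota> t) \<and> eval model p t = Some (rep (?\<iota> t))" if "t \<in> set ts" for t
    using Fun that by auto
  have lang: "lang_trm L (Fun f (map ?\<iota> ts))" using IH Fun.prems by simp
  have "those (map (eval model p) ts) = Some (map rep (map ?\<iota> ts))"
    using IH by (simp add: those_eq_Some_iff)
  moreover have "oper model f (map rep (map ?\<iota> ts)) = Some (rep (Fun f (map rep (map ?\<iota> ts))))"
    by (rule oper_model) (use IH Fun.prems in \<open>auto intro: rep_in_model\<close>)
  ultimately show ?case using lang rep_Fun_rep[OF lang] by simp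
qed

lemma holds_model_Eq:
  assumes "p \<in> tuples model m" "wf_fm L m (Eq s t)"
  shows "holds model p (Eq s t) \<longleftrightarrow> eqv (subst_trm (\<lambda>i. p ! i) s) (subst_trm (\<lambda>i. p ! i) t)"
  using eval_model[OF assms(1), of s] eval_model[OF assms(1), of t] assms(2) rep_eq_iff
  by (auto simp: wf_fm_def intro: eqv_sym)

text \<open>If all literals fail at \<open>p\<close>, the equations of the negative ones are forced, hence so is the
  remaining literal \<open>\<chi>\<close>, taken to be \<open>Bot\<close> if the clause has no positive literal.  A forced equation
  holds in the quotient, and \<open>Bot\<close> is not forced, so both cases are contradictory.\<close>

lemma model_satisfies_clause:
  assumes \<sigma>: "Univ m (Conj cs) \<in> \<Sigma>" and wf: "wf_fm L m (Conj cs)" and ls: "Disj ls \<in> set cs"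
    and lits: "\<forall>l\<in>set ls. atomic l \<or> negated_atomic l" "length (filter atomic ls) \<le> 1"
    and p: "p \<in> tuples model m"
  shows "holds model p (Disj ls)"
proof (rule ccontr)
  assume "\<not> holds model p (Disj ls)"
  then have fails: "\<not> holds model p l" if "l \<in> set ls" for l using that by (auto simp: holds_Disj)
  have wf_ls: "wf_fm L m l" if "l \<in> set ls" for l
    using that wf ls
    by (auto simp: wf_fm_def lang_fm_Conj free_below_Conj lang_fm_Disj free_below_Disj)
  obtain \<chi> where \<chi>: "\<chi> = Bot \<or> \<chi> \<in> set ls \<and> atomic \<chi>" "\<forall>l\<in>set ls. atomic l \<longrightarrow> l = \<chi>"
  proof (cases "filter atomic ls")
    case Nil
    then show ?thesis using that[of Bot] by (auto simp: filter_empty_conv)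
  next
    case (Cons x xs)
    then have "filter atomic ls = [x]" using lits(2) by simp
    then have "{l \<in> set ls. atomic l} = {x}" by (metis list.set(1) list.simps(15) set_filter)
    then show ?thesis using that[of x] by blast
  qed
  have wf_\<chi>: "wf_fm L m \<chi>" using \<chi>(1) wf_ls by (auto simp: wf_fm_def)
  \<comment> \<open>The instance of the clause at \<open>p\<close>, under a naming \<open>e\<close> of the elements of \<open>P\<close>.\<close>
  define r where "r e i = named e (p ! i)" for e i
  have lang_r: "lang_trm L (r e i)" if "i < m" for e i
  proof -
    have "p ! i \<in> univ model" using p that by (auto simp: tuples_def)
    then show ?thesis by (simp add: r_def lang_trm_named univ_modelD)
  qed
  have subst_r: "subst_trm (r e) t = named e (subst_trm (\<lambda>i. p ! i) t)" for e t
    by (simp add: r_def[abs_def] named_def subst_trm_subst_trm)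
  have lang_subst: "lang_fm L (subst_fm (r e) \<phi>)" if "wf_fm L m \<phi>" for e \<phi>
    using that lang_fm_subst[OF _ _ lang_r] by (auto simp: wf_fm_def)
  let ?I = "(\<lambda>(s, t). Neg (Eq s t)) -` set ls"
  let ?\<phi> = "\<lambda>(s, t) e. subst_fm (r e) (Eq s t)"
  have "forced (\<lambda>e. subst_fm (r e) \<chi>)"
  proof (rule forced_combine[of ?I ?\<phi>])
    show "finite ?I" by (rule finite_vimageI) (auto simp: inj_on_def)
  next
    fix i assume "i \<in> ?I"
    then obtain s t where i: "i = (s, t)" "Neg (Eq s t) \<in> set ls" by (cases i) auto
    have "holds model p (Eq s t)" using fails[OF i(2)] by simp
    moreover have "wf_fm L m (Eq s t)" using wf_ls[OF i(2)] by (simp add: wf_fm_def)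
    ultimately have "eqv (subst_trm (\<lambda>i. p ! i) s) (subst_trm (\<lambda>i. p ! i) t)"
      using holds_model_Eq[OF p] by blast
    then show "forced (?\<phi> i)" by (simp add: i eqv_def subst_r)
  next
    fix e \<Delta>
    assume \<Delta>: "sentence ` \<Sigma> \<subseteq> \<Delta>" and neg: "\<And>i. i \<in> ?I \<Longrightarrow> derives L \<Delta> (?\<phi> i e)"
    have "(All ^^ m) (Conj cs) \<in> \<Delta>" using \<Delta> \<sigma> by force
    then have "derives L \<Delta> (subst_fm (r e) (Conj cs))"
      by (rule derives_instance[OF derives.Assm]) (use wf lang_r in \<open>auto simp: wf_fm_def\<close>)
    then have "derives L \<Delta> (Conj (map (subst_fm (r e)) cs))" by (simp add: subst_fm_Conj)
    then have "derives L \<Delta> (subst_fm (r e) (Disj ls))"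
      by (rule derives_ConjE) (use lang_subst[OF wf, of e] ls in \<open>auto simp: subst_fm_Conj\<close>)
    then have d: "derives L \<Delta> (Disj (map (subst_fm (r e)) ls))" by (simp add: subst_fm_Disj)
    show "derives L \<Delta> (subst_fm (r e) \<chi>)"
    proof (rule derives_DisjE[OF d])
      show "lang_fm L (Disj (map (subst_fm (r e)) ls))"
        using lang_subst wf_ls by (auto simp: lang_fm_Disj)
      show "lang_fm L (subst_fm (r e) \<chi>)" by (rule lang_subst[OF wf_\<chi>])
    next
      fix \<phi> assume "\<phi> \<in> set (map (subst_fm (r e)) ls)"
      then obtain l where l: "l \<in> set ls" "\<phi> = subst_fm (r e) l" by auto
      show "derives L (insert \<phi> \<Delta>) (subst_fm (r e) \<chi>)"
      proof (cases "atomic l")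
        case True
        then show ?thesis using \<chi>(2) l by (simp add: derives_insertI)
      next
        case False
        then obtain s t where st: "l = Neg (Eq s t)"
          using lits(1) l(1) by (auto simp: negated_atomic_def atomic_def)
        have "derives L \<Delta> (subst_fm (r e) (Eq s t))" using neg[of "(s, t)"] l(1) st by simp
        then have "derives L (insert \<phi> \<Delta>) Bot"
          using derives.ImpE[OF derives_insertI derives_insert] l(2) st by simp
        then show ?thesis by (rule derives_ex_falso[OF lang_subst[OF wf_\<chi>]])
      qed
    qed
  qed
  show False
  proof (cases "\<chi> = Bot")
    case True
    then show ?thesis using \<open>forced (\<lambda>e. subst_fm (r e) \<chi>)\<close> not_forced_Bot by simp
  next
    case False
    then obtain s t where st: "\<chi> = Eq s t" "\<chi> \<in> set ls" using \<chi>(1) by (auto simp: atomic_def)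
    have "lang_trm L (subst_trm (\<lambda>i. p ! i) s)" "lang_trm L (subst_trm (\<lambda>i. p ! i) t)"
      using eval_model[OF p] wf_\<chi> st(1) by (auto simp: wf_fm_def)
    then have "eqv (subst_trm (\<lambda>i. p ! i) s) (subst_trm (\<lambda>i. p ! i) t)"
      using \<open>forced (\<lambda>e. subst_fm (r e) \<chi>)\<close> by (simp add: eqv_def st(1) subst_r)
    then have "holds model p \<chi>" using holds_model_Eq[OF p] wf_\<chi> st(1) by simp
    then show ?thesis using fails st(2) by blast
  qed
qed

lemma model_in_Mod: "model \<in> Mod L \<Sigma>"
proof -
  have "satisfies model \<sigma>" if "\<sigma> \<in> \<Sigma>" for \<sigma> :: "'f usent"
  proof (cases \<sigma>)
    case (Univ m \<omega>)
    then obtain cs where cs: "\<omega> = Conj cs" "\<forall>c\<in>set cs. horn_clause c" and wf: "wf_fm L m \<omega>"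
      using horn[OF \<open>\<sigma> \<in> \<Sigma>\<close>] by (auto simp: horn_formula_def)
    have "holds model p c" if "p \<in> tuples model m" "c \<in> set cs" for p c
      using cs(2) that model_satisfies_clause[of m cs] \<open>\<sigma> \<in> \<Sigma>\<close> wf Univ cs(1)
      by (auto simp: horn_clause_def)
    then show ?thesis by (auto simp: Univ cs(1) holds_Conj Dom_def)
  qed
  moreover have "univ model \<noteq> {}" using rep_in_model[of "Var undefined"] by auto
  ultimately show ?thesis using total_model by (simp add: Mod_def)
qed

lemma embedding_model: "embedding L P model (\<lambda>a. rep (Var a))"
proof -
  let ?\<alpha> = "\<lambda>a. rep (Var a)"
  have "inj_on ?\<alpha> (univ P)"
  proof (rule inj_onI)
    fix a b assume ab: "a \<in> univ P" "b \<in> univ P" "?\<alpha> a = ?\<alpha> b"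
    then have "eqv (Var a) (Var b)" by (simp add: rep_eq_iff)
    then show "a = b" using forced_Var_eq ab by (simp add: eqv_def named_def)
  qed
  moreover have "?\<alpha> ` univ P \<subseteq> univ model" by (auto intro: rep_in_model)
  moreover have "oper model f (map ?\<alpha> p) = Some (?\<alpha> b)" if "f \<in> dom L" "oper P f p = Some b" for f p b
  proof -
    have f: "L f = Some (length p)"
      using that partial by (fastforce simp: partial_algebra_def tuples_def)
    have "oper model f (map ?\<alpha> p) = Some (rep (Fun f (map ?\<alpha> p)))"
      by (rule oper_model) (use f in \<open>auto intro: rep_in_model\<close>)
    also have "rep (Fun f (map ?\<alpha> p)) = rep (Fun f (map Var p))"
      using rep_Fun_rep[of f "map Var p"] f by (simp add: comp_def)
    also have "\<dots> = ?\<alpha> b"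
      using eqv_diagram[OF f that(2)] by (metis eqv_def rep_eq_iff)
    finally show ?thesis .
  qed
  ultimately show ?thesis unfolding embedding_def by fastforce
qed

end

text \<open>Relativizing weakens a sentence, so relativizations remain derivable.\<close>

lemma derives_relativize:
  assumes "\<forall>\<sigma>\<in>\<Sigma>. universal_horn L \<sigma>" and "wf_fm L 1 \<delta>" and "derives L (sentence ` \<Sigma>) \<omega>"
  shows "derives L (sentence ` \<Sigma>) (sentence (relativize \<delta> (Univ m \<omega>)))"
proof -
  let ?\<delta>s = "map (\<lambda>i. subst_fm (\<lambda>_. Var i) \<delta>) [0..<m]"
  have "free_below 0 (sentence \<sigma>)" if "\<sigma> \<in> \<Sigma>" for \<sigma>
    using assms(1) that by (cases \<sigma>) (auto simp: free_below_All_power wf_fm_def)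
  moreover have "derives L (sentence ` \<Sigma>) (Imp (Conj ?\<delta>s) \<omega>)"
  proof (rule derives.ImpI)
    show "lang_fm L (Conj ?\<delta>s)"
      using assms(2) by (auto simp: lang_fm_Conj wf_fm_def intro: lang_fm_subst[of _ _ 1])
  qed (rule derives_insert[OF assms(3)])
  ultimately show ?thesis by (auto intro: derives_All_powerI)
qed

theorem theorem2p4:
  fixes L :: "'f lang"
    and \<P> :: "('f, 'a) palg set"
    and \<Sigma> :: "'f usent set"
    and \<delta> :: "'f fm"
  assumes "\<forall>P\<in>\<P>. partial_algebra L P"
    and "\<forall>\<sigma>\<in>\<Sigma>. universal_horn L \<sigma>"
    and "conj_of_atoms \<delta>" and "wf_fm L 1 \<delta>"
    and "\<forall>\<sigma>\<in>\<Sigma>. law \<P> \<sigma>"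
    and "law \<P> (Univ 1 \<delta>)"
    and "total_for \<P> 1 \<delta>"
  shows "((\<forall>\<sigma>. universal_horn L \<sigma> \<longrightarrow> derives L (sentence ` \<Sigma>) (sentence (relativize \<delta> \<sigma>)) \<longrightarrow> law \<P> \<sigma>)
           \<longleftrightarrow> embeds_into_Mod TYPE(('f, 'a) trm) L \<P> \<Sigma>)
       \<and> (embeds_into_Mod TYPE('u) L \<P> \<Sigma> \<longrightarrow> embeds_into_Mod TYPE(('f, 'a) trm) L \<P> \<Sigma>)"
proof -
  let ?laws = "\<forall>\<sigma>. universal_horn L \<sigma> \<longrightarrow>
    derives L (sentence ` \<Sigma>) (sentence (relativize \<delta> \<sigma>)) \<longrightarrow> law \<P> \<sigma>"
  have \<delta>: "quantifier_free \<delta>" "lang_fm L \<delta>"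
    using assms(3,4) by (auto simp: quantifier_free_conj_of_atoms wf_fm_def)
  have from_laws: "embeds_into_Mod TYPE(('f, 'a) trm) L \<P> \<Sigma>" if ?laws
    unfolding embeds_into_Mod_def
  proof
    fix P assume P: "P \<in> \<P>"
    interpret presentation L \<Sigma> P
    proof
      show "partial_algebra L P" using assms(1) P by blast
      show "universal_horn L \<sigma>" if "\<sigma> \<in> \<Sigma>" for \<sigma> using assms(2) that by blast
      show "satisfies P (Univ m \<omega>)"
        if "universal_horn L (Univ m \<omega>)" "derives L (sentence ` \<Sigma>) \<omega>" for m \<omega>
        using \<open>?laws\<close>[rule_format, OF that(1) derives_relativize[OF assms(2,4) that(2)]] P
        unfolding law_def by blast
    qed
    show "\<exists>Q\<in>Mod L \<Sigma> :: ('f, ('f, 'a) trm) palg set. \<exists>\<alpha>. embedding L P Q \<alpha>"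
      using model_in_Mod embedding_model by blast
  qed
  moreover have ?laws if "embeds_into_Mod TYPE(('f, 'a) trm) L \<P> \<Sigma>"
    using relativized_consequence_law[OF assms(1,2) \<delta> assms(6,7) that] by blast
  moreover have ?laws if "embeds_into_Mod TYPE('u) L \<P> \<Sigma>"
    using relativized_consequence_law[OF assms(1,2) \<delta> assms(6,7) that] by blast
  ultimately show ?thesis by blast
qed

end
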